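(* Let $q$ be a prime power, let $V$ be a quasiprojective variety defined over $\mathbb{F}_q$, and let $\phi:V\to V$ be an endomorphism of $V$ defined over $\mathbb{F}_q$. Let $G$ be a finite abelian subgroup of $\operatorname{Aut}_{\mathbb{F}_q}(V)$ such that $\phi\circ g=g\circ\phi$ for every $g\in G$. Then $$\bigl|\operatorname{Per}_{\phi_G}((V/G)(\mathbb{F}_q))\bigr|=\frac{1}{|G|}\sum_{\chi\in H^1(\operatorname{Gal}(\overline{\mathbb{F}}_q/\mathbb{F}_q),G)}\bigl|\operatorname{Per}_{\phi_\chi}(V^\chi(\mathbb{F}_q))\bigr|.$$
   Context: $V/G$ denotes the quotient variety with projection $\pi:V\to V/G$, and $\phi_G:V/G\to V/G$ is the morphism induced by $\phi$, i.e. $\phi_G\circ\pi=\pi\circ\phi$. For a map $f:W\to W$, a point $P\in W(\overline{\mathbb{F}}_q)$ is periodic if $f^n(P)=P$ for some $n\ge 1$; $\operatorname{Per}_f(W(\mathbb{F}_q))$ is the set of periodic points of $f$ lying in $W(\mathbb{F}_q)$. Since the Galois group acts trivially on $G$ and $G$ is abelian, $H^1(\operatorname{Gal}(\overline{\mathbb{F}}_q/\mathbb{F}_q),G)$ is the set of continuous homomorphisms $\chi:\operatorname{Gal}(\overline{\mathbb{F}}_q/\mathbb{F}_q)\to G$, $\sigma\mapsto\chi_\sigma$. For such $\chi$, $V^\chi$ is the twist of $V$ by $\chi$: a variety over $\mathbb{F}_q$ with an $\overline{\mathbb{F}}_q$-isomorphism $\psi_\chi:V\to V^\chi$ such that $\psi_\chi$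 identifies $V^\chi(\mathbb{F}_q)$ with $\{Q\in V(\overline{\mathbb{F}}_q): Q=\chi_\sigma(Q^\sigma)\text{ for all }\sigma\in\operatorname{Gal}(\overline{\mathbb{F}}_q/\mathbb{F}_q)\}$. The twisted map is $\phi_\chi:=\psi_\chi\circ\phi\circ\psi_\chi^{-1}:V^\chi\to V^\chi$. *)

theory Defs
  imports
    "HOL-Analysis.Abstract_Topology"
    "HOL-Library.Cardinality"
    "HOL-Algebra.Algebraic_Closure_Type"
    "HOL-Algebra.Bij"
    "HOL-Library.Poly_Mapping"
begin

text \<open>
  The finite field is a type \<open>'k :: finite_field\<close>, and its algebraic closure is the library type
  \<open>'k alg_closure\<close> with embedding \<^const>\<open>to_ac\<close>. Varieties are identified with their sets of
  points over the algebraic closure, and all geometric objects carry a field of definition \<open>k\<close>,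
  a subset of the big field: \<open>range to_ac\<close> for ``over the finite field'', \<open>UNIV\<close> for ``geometric''.
\<close>

section \<open>Polynomials in countably many variables\<close>

type_synonym 'K mpoly = "(nat \<Rightarrow>\<^sub>0 nat) \<Rightarrow>\<^sub>0 'K"

definition peval :: "'K::comm_semiring_1 mpoly \<Rightarrow> (nat \<Rightarrow> 'K) \<Rightarrow> 'K" where
  "peval p x = (\<Sum>m\<in>Poly_Mapping.keys p. Poly_Mapping.lookup p m *
                  (\<Prod>i\<in>Poly_Mapping.keys m. x i ^ Poly_Mapping.lookup m i))"

definition form :: "'K::zero set \<Rightarrow> nat \<Rightarrow> 'K mpoly \<Rightarrow> bool" where
  "form k d p \<longleftrightarrow> (\<forall>m\<in>Poly_Mapping.keys p.
     Poly_Mapping.lookup p m \<in> k \<and> (\<Sum>i\<in>Poly_Mapping.keys m. Poly_Mapping.lookup m i) = d)"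

section \<open>Projective space and quasiprojective varieties\<close>

text \<open>
  A vector of homogeneous coordinates \<open>[x\<^sub>0 : \<dots> : x\<^sub>n]\<close> is padded with zeros to a function on
  \<^typ>\<open>nat\<close>, and a point is the class of all its nonzero multiples. Hence all projective spaces
  have the same type, the \<open>n\<close>-dimensional one being the linear subspace \<open>x\<^sub>i = 0\<close> (\<open>i > n\<close>) of the
  larger ones, and forms may mention variables beyond \<open>x\<^sub>n\<close>, which evaluate to zero.
\<close>

type_synonym 'K point = "(nat \<Rightarrow> 'K) set"

definition coord_vectors :: "nat \<Rightarrow> (nat \<Rightarrow> 'K::field) set" where
  "coord_vectors n = {x. (\<exists>i. x i \<noteq> 0) \<and> (\<forall>i>n. x i = 0)}"

definition scaling_rel :: "((nat \<Rightarrow> 'K::field) \<times> (nat \<Rightarrow> 'K)) set" where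
  "scaling_rel = {(x, y). \<exists>c. c \<noteq> 0 \<and> y = (\<lambda>i. c * x i)}"

definition proj_space :: "nat \<Rightarrow> 'K::field point set" where
  "proj_space n = coord_vectors n // scaling_rel"

definition vanishes_at :: "'K::field mpoly \<Rightarrow> 'K point \<Rightarrow> bool" where
  "vanishes_at p P \<longleftrightarrow> (\<forall>x\<in>P. peval p x = 0)"

definition zero_locus :: "nat \<Rightarrow> 'K::field mpoly set \<Rightarrow> 'K point set" where
  "zero_locus n S = {P \<in> proj_space n. \<forall>p\<in>S. vanishes_at p P}"

definition quasiprojective :: "'K::field set \<Rightarrow> 'K point set \<Rightarrow> bool" where
  "quasiprojective k V \<longleftrightarrow> (\<exists>n S T. (\<forall>p\<in>S \<union> T. \<exists>d. form k d p) \<and>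
     V = zero_locus n S - zero_locus n T)"

text \<open>
  The generating sets are the basic open sets \<open>D(p) \<inter> V\<close>; they are closed under binary
  intersection, since \<open>D(p) \<inter> D(p') = D(p * p')\<close>.
\<close>
definition zariski_topology :: "'K::field point set \<Rightarrow> 'K point topology" where
  "zariski_topology V =
     topology_generated_by {{P \<in> V. \<not> vanishes_at p P} |p. \<exists>d. form UNIV d p}"

text \<open>
  A map is a morphism over \<open>k\<close> if near every point it has the shape \<open>[F\<^sub>0 : F\<^sub>1 : \<dots>]\<close> for forms
  \<open>F\<^sub>i\<close> over \<open>k\<close> of equal degree without common zero at that point. Since \<open>f Q\<close> is a class of
  coordinate vectors, \<open>f Q = [F\<^sub>0(x) : F\<^sub>1(x) : \<dots>]\<close> is expressed by membership; it forces
  \<open>F\<^sub>i(x) = 0\<close> for \<open>i\<close> beyond the dimension of the target. Agreement is demanded wherever the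
  \<open>F\<^sub>i\<close> have no common zero; this loses nothing against agreement on a neighbourhood of \<open>P\<close>, as all
  the \<open>F\<^sub>i\<close> can be multiplied by a form that vanishes outside that neighbourhood but not at \<open>P\<close>.
\<close>
definition morphism ::
  "'K::field set \<Rightarrow> 'K point set \<Rightarrow> 'K point set \<Rightarrow> ('K point \<Rightarrow> 'K point) \<Rightarrow> bool" where
  "morphism k V W f \<longleftrightarrow> f \<in> V \<rightarrow> W \<and>
     (\<forall>P\<in>V. \<exists>d F. (\<forall>i. form k d (F i)) \<and> (\<exists>i. \<not> vanishes_at (F i) P) \<and>
        (\<forall>Q\<in>V. \<forall>x\<in>Q. (\<exists>i. peval (F i) x \<noteq> 0) \<longrightarrow> (\<lambda>i. peval (F i) x) \<in> f Q))"

definition isomorphism ::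
  "'K::field set \<Rightarrow> 'K point set \<Rightarrow> 'K point set \<Rightarrow> ('K point \<Rightarrow> 'K point) \<Rightarrow> bool" where
  "isomorphism k V W f \<longleftrightarrow>
     bij_betw f V W \<and> morphism k V W f \<and> morphism k W V (inv_into V f)"

definition regular_function ::
  "'K::field point set \<Rightarrow> ('K point \<Rightarrow> 'K) \<Rightarrow> bool" where
  "regular_function U h \<longleftrightarrow>
     (\<forall>P\<in>U. \<exists>d a b. form UNIV d a \<and> form UNIV d b \<and> \<not> vanishes_at b P \<and>
        (\<forall>Q\<in>U. \<forall>x\<in>Q. peval b x \<noteq> 0 \<longrightarrow> h Q = peval a x / peval b x))"

text \<open>As in \<^const>\<open>BijGroup\<close>, automorphisms are made extensional so that each is counted once.\<close>
definition aut_group ::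
  "'K::field set \<Rightarrow> 'K point set \<Rightarrow> ('K point \<Rightarrow> 'K point) monoid" where
  "aut_group k V = BijGroup V \<lparr>carrier := {g \<in> Bij V. isomorphism k V V g}\<rparr>"

section \<open>Quotients by finite groups\<close>

text \<open>
  The quotient variety in the usual sense (Mumford, Abelian Varieties, Section 7): \<open>W\<close> is the orbit
  space as a set and as a topological space, and the regular functions on an open \<open>U \<subseteq> W\<close> are the
  \<open>G\<close>-invariant regular functions on \<open>\<pi>\<^sup>-\<^sup>1(U)\<close>. It is unique up to isomorphism.
\<close>
definition quotient_variety ::
  "'K::field set \<Rightarrow> 'K point set \<Rightarrow> ('K point \<Rightarrow> 'K point) set \<Rightarrow> 'K point set
     \<Rightarrow> ('K point \<Rightarrow> 'K point) \<Rightarrow> bool" where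
  "quotient_variety k V G W \<pi> \<longleftrightarrow>
     quasiprojective k W \<and> morphism k V W \<pi> \<and>
     quotient_map (zariski_topology V) (zariski_topology W) \<pi> \<and>
     (\<forall>P\<in>V. \<forall>Q\<in>V. \<pi> P = \<pi> Q \<longleftrightarrow> (\<exists>g\<in>G. Q = g P)) \<and>
     (\<forall>U h. openin (zariski_topology W) U \<longrightarrow>
        (regular_function U h \<longleftrightarrow> regular_function {P \<in> V. \<pi> P \<in> U} (h \<circ> \<pi>)))"

section \<open>The Galois group and its first cohomology\<close>

abbreviation base_field :: "'k::field alg_closure set" where
  "base_field \<equiv> range to_ac"

definition galois_set :: "('k::field alg_closure \<Rightarrow> 'k alg_closure) set" where
  "galois_set = {\<sigma>. bij \<sigma> \<and> (\<forall>x y. \<sigma> (x + y) = \<sigma> x + \<sigma> y) \<and>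
     (\<forall>x y. \<sigma> (x * y) = \<sigma> x * \<sigma> y) \<and> (\<forall>a\<in>base_field. \<sigma> a = a)}"

definition galois_group :: "('k::field alg_closure \<Rightarrow> 'k alg_closure) monoid" where
  "galois_group = \<lparr>carrier = galois_set, monoid.mult = (\<circ>), one = id\<rparr>"

text \<open>
  Cosets of the subgroups fixing a finite set \<open>S\<close>, i.e. of the Galois groups of the closure over
  the finite extensions generated by such \<open>S\<close>.
\<close>
definition krull_topology :: "('k::field alg_closure \<Rightarrow> 'k alg_closure) topology" where
  "krull_topology = topology_generated_by
     {{\<tau> \<in> galois_set. \<forall>x\<in>S. \<tau> x = \<sigma> x} |\<sigma> S. \<sigma> \<in> galois_set \<and> finite S}"

definition galois_act ::
  "('k::field alg_closure \<Rightarrow> 'k alg_closure) \<Rightarrow> 'k alg_closure point \<Rightarrow> 'k alg_closure point" where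
  "galois_act \<sigma> P = (\<lambda>x. \<sigma> \<circ> x) ` P"

text \<open>
  \<open>G\<close> is an abelian group of automorphisms over the finite field, so the Galois group acts trivially
  on it and \<open>H\<^sup>1\<close> is the set of continuous homomorphisms, \<open>G\<close> being discrete. They are
  extensional so that each is counted once.
\<close>
definition H1 ::
  "'k::field alg_closure point set \<Rightarrow> ('k alg_closure point \<Rightarrow> 'k alg_closure point) set
     \<Rightarrow> (('k alg_closure \<Rightarrow> 'k alg_closure) \<Rightarrow> 'k alg_closure point \<Rightarrow> 'k alg_closure point) set"
where
  "H1 V G = {\<xi> \<in> hom galois_group (aut_group base_field V \<lparr>carrier := G\<rparr>) \<inter> extensional galois_set.
     continuous_map krull_topology (discrete_topology G) \<xi>}"

section \<open>Rational points, twists, periodic points\<close>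

definition rational_points ::
  "'k::field alg_closure point set \<Rightarrow> 'k alg_closure point set" where
  "rational_points V = {P \<in> V. \<exists>x\<in>P. \<forall>i. x i \<in> base_field}"

text \<open>
  The cocycle condition \<open>\<psi>\<^sup>-\<^sup>1 \<circ> \<psi>\<^sup>\<sigma> = \<xi>\<^sub>\<sigma>\<close>, evaluated at \<open>Q\<^sup>\<sigma>\<close>. The resulting description
  of the rational points of the twist is \<open>twist_rational_points\<close> below.
\<close>
definition is_twist ::
  "'k::field alg_closure point set
     \<Rightarrow> (('k alg_closure \<Rightarrow> 'k alg_closure) \<Rightarrow> 'k alg_closure point \<Rightarrow> 'k alg_closure point)
     \<Rightarrow> 'k alg_closure point set \<Rightarrow> ('k alg_closure point \<Rightarrow> 'k alg_closure point) \<Rightarrow> bool" where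
  "is_twist V \<xi> V' \<psi> \<longleftrightarrow> quasiprojective base_field V' \<and> isomorphism UNIV V V' \<psi> \<and>
     (\<forall>\<sigma>\<in>galois_set. \<forall>Q\<in>V. galois_act \<sigma> (\<psi> Q) = \<psi> (\<xi> \<sigma> (galois_act \<sigma> Q)))"

definition twisted_map :: "'p set \<Rightarrow> ('p \<Rightarrow> 'p) \<Rightarrow> ('p \<Rightarrow> 'p) \<Rightarrow> 'p \<Rightarrow> 'p" where
  "twisted_map V \<phi> \<psi> = \<psi> \<circ> \<phi> \<circ> inv_into V \<psi>"

definition periodic_points :: "('p \<Rightarrow> 'p) \<Rightarrow> 'p set \<Rightarrow> 'p set" where
  "periodic_points f A = {P \<in> A. \<exists>n\<ge>1. (f ^^ n) P = P}"

section \<open>Basic consequences\<close>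

lemma topspace_zariski_topology:
  fixes V :: "'a::field point set"
  shows "topspace (zariski_topology V) = {P \<in> V. P \<noteq> {}}"
proof -
  let ?one = "Poly_Mapping.single 0 1 :: 'a mpoly"
  have one: "form UNIV 0 ?one" "vanishes_at ?one P \<longleftrightarrow> P = {}" for P
    by (auto simp: form_def vanishes_at_def peval_def)
  have empty: "vanishes_at p {}" for p :: "'a mpoly"
    by (simp add: vanishes_at_def)
  show ?thesis
  proof (rule Set.set_eqI)
    fix P
    have "P \<in> topspace (zariski_topology V) \<longleftrightarrow>
        (\<exists>p. (\<exists>d. form UNIV d p) \<and> P \<in> V \<and> \<not> vanishes_at p P)"
      unfolding zariski_topology_def topology_generated_by_topspace by auto
    also have "\<dots> \<longleftrightarrow> P \<in> V \<and> P \<noteq> {}"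
      using one empty by metis
    finally show "P \<in> topspace (zariski_topology V) \<longleftrightarrow> P \<in> {P \<in> V. P \<noteq> {}}"
      by simp
  qed
qed

lemma galois_setD:
  assumes "\<sigma> \<in> galois_set"
  shows "bij \<sigma>" "\<sigma> (x + y) = \<sigma> x + \<sigma> y" "\<sigma> (x * y) = \<sigma> x * \<sigma> y" "\<sigma> (to_ac a) = to_ac a"
    "\<sigma> 0 = 0" "\<sigma> 1 = 1"
proof -
  show *: "bij \<sigma>" "\<sigma> (x + y) = \<sigma> x + \<sigma> y" "\<sigma> (x * y) = \<sigma> x * \<sigma> y" "\<sigma> (to_ac a) = to_ac a"
    for x y a using assms by (auto simp: galois_set_def)
  show "\<sigma> 0 = 0" "\<sigma> 1 = 1" using *(4)[of 0] *(4)[of 1] by simp_all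
qed

lemma galois_peval:
  assumes \<sigma>: "\<sigma> \<in> galois_set" and p: "form base_field d p"
  shows "peval p (\<sigma> \<circ> x) = \<sigma> (peval p x)"
proof -
  note s = galois_setD[OF \<sigma>]
  have sm: "\<sigma> (sum f A) = (\<Sum>a\<in>A. \<sigma> (f a))" for f :: "(nat \<Rightarrow>\<^sub>0 nat) \<Rightarrow> 'a alg_closure" and A
    by (induction A rule: infinite_finite_induct) (simp_all add: s)
  have pw: "\<sigma> (y ^ n) = \<sigma> y ^ n" for y n
    by (induction n) (simp_all add: s)
  have pd: "\<sigma> (prod f A) = (\<Prod>a\<in>A. \<sigma> (f a))" for f :: "nat \<Rightarrow> 'a alg_closure" and A
    by (induction A rule: infinite_finite_induct) (simp_all add: s)
  have "\<sigma> (Poly_Mapping.lookup p m) = Poly_Mapping.lookup p m" if m: "m \<in> Poly_Mapping.keys p" for m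
  proof -
    obtain a where "Poly_Mapping.lookup p m = to_ac a"
      using p m by (auto simp: form_def)
    thus ?thesis by (simp add: s)
  qed
  thus ?thesis
    by (auto simp: peval_def sm s(3) pd pw intro!: sum.cong)
qed

lemma frobenius_in_galois_set:
  "(\<lambda>x :: 'k::finite_field alg_closure. x ^ CARD('k)) \<in> galois_set"
proof -
  define q where "q = CARD('k)"
  have q: "q > 0" by (simp add: q_def)
  have choose: "of_nat (q choose j) = (0 :: 'k)" if j: "0 < j" "j < q" for j
  proof -
    define f :: "'k poly" where "f = (\<Sum>i\<in>{1..<q}. Polynomial.monom (of_nat (q choose i)) i)"
    have "poly f x = 0" for x
    proof -
      have "(x + 1) ^ q = (\<Sum>i\<le>q. of_nat (q choose i) * x ^ i)"
        by (subst binomial_ring) simp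
      also have "{..q} = {0, q} \<union> {1..<q}" using q by auto
      also have "(\<Sum>i\<in>\<dots>. of_nat (q choose i) * x ^ i) = 1 + x ^ q + poly f x"
        using q by (subst sum.union_disjoint) (auto simp: f_def poly_sum poly_monom)
      finally show ?thesis
        using finite_field_power_card_eq_same[of x] finite_field_power_card_eq_same[of "x + 1"]
        by (simp add: q_def)
    qed
    moreover have "Polynomial.degree f < q"
      unfolding f_def by (rule le_less_trans[OF degree_sum_le[of _ _ "q - 1"]])
        (use q in \<open>auto intro!: order_trans[OF degree_monom_le]\<close>)
    ultimately have "f = 0"
      using card_poly_roots_bound[of f] by (auto simp: q_def)
    moreover have "Polynomial.coeff f j = of_nat (q choose j)"
      using j by (simp add: f_def coeff_sum)
    ultimately show ?thesis by simp
  qed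
  have choose': "of_nat (q choose j) = (0 :: 'k alg_closure)" if "0 < j" "j < q" for j
    using choose[OF that] to_ac_of_nat[of "q choose j", where ?'a = 'k] by simp
  have add: "(x + y) ^ q = x ^ q + y ^ q" for x y :: "'k alg_closure"
  proof -
    have "(x + y) ^ q = (\<Sum>i\<le>q. of_nat (q choose i) * x ^ i * y ^ (q - i))"
      by (rule binomial_ring)
    also have "\<dots> = (\<Sum>i\<in>{0, q}. of_nat (q choose i) * x ^ i * y ^ (q - i))"
    proof (intro sum.mono_neutral_right ballI)
      fix i assume "i \<in> {..q} - {0, q}"
      hence "0 < i" "i < q" by auto
      thus "of_nat (q choose i) * x ^ i * y ^ (q - i) = 0" by (simp add: choose')
    qed auto
    also have "\<dots> = x ^ q + y ^ q" using q by simp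
    finally show ?thesis .
  qed
  have "inj (\<lambda>x :: 'k alg_closure. x ^ q)"
  proof (rule injI)
    fix x y :: "'k alg_closure" assume "x ^ q = y ^ q"
    moreover have "x ^ q = (x - y) ^ q + y ^ q" using add[of "x - y" y] by simp
    ultimately show "x = y" using q by simp
  qed
  moreover have "surj (\<lambda>x :: 'k alg_closure. x ^ q)"
    using nth_root_exists[OF q] by (metis surjI)
  moreover have "to_ac a ^ q = to_ac a" for a :: 'k
    using finite_field_power_card_eq_same[of a] by (simp add: q_def flip: to_ac_power)
  ultimately show ?thesis
    unfolding galois_set_def q_def[symmetric] by (auto simp: bij_def add power_mult_distrib)
qed

lemma galois_fixed_field:
  fixes x :: "'k::finite_field alg_closure"
  assumes "\<forall>\<sigma>\<in>galois_set. \<sigma> x = x"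
  shows "x \<in> base_field"
proof (rule ccontr)
  assume x: "x \<notin> base_field"
  define q where "q = CARD('k)"
  have q: "q \<ge> 2"
    using card_mono[of UNIV "{0, 1 :: 'k}"] by (simp add: q_def)
  define f :: "'k alg_closure poly" where "f = Polynomial.monom 1 q - Polynomial.monom 1 1"
  have "Polynomial.coeff f q = 1" using q by (simp add: f_def)
  hence f: "f \<noteq> 0" by auto
  have deg: "Polynomial.degree f \<le> q"
    unfolding f_def using q by (intro degree_diff_le) (auto intro: order_trans[OF degree_monom_le])
  have ev: "poly f y = y ^ q - y" for y by (simp add: f_def poly_monom)
  have "to_ac a ^ q = to_ac a" for a :: 'k
    using finite_field_power_card_eq_same[of a] by (simp add: q_def flip: to_ac_power)
  moreover have "x ^ q = x"
    using assms frobenius_in_galois_set by (force simp: q_def)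
  ultimately have "insert x base_field \<subseteq> {y. poly f y = 0}" by (auto simp: ev)
  moreover have "card (base_field :: 'k alg_closure set) = q"
    by (simp add: q_def card_image inj_to_ac)
  ultimately have "Suc q \<le> card {y. poly f y = 0}"
    using x card_mono[OF poly_roots_finite[OF f], of "insert x base_field"] by simp
  thus False using card_poly_roots_bound[OF f] deg by simp
qed

lemma proj_spaceE:
  assumes "P \<in> proj_space n"
  obtains x where "x \<in> coord_vectors n" "P = {y. \<exists>c. c \<noteq> 0 \<and> y = (\<lambda>i. c * x i)}"
  using assms by (auto simp: proj_space_def scaling_rel_def quotient_def)

lemma proj_space_nonempty: "P \<in> proj_space n \<Longrightarrow> P \<noteq> {}"
  by (erule proj_spaceE) (auto intro: exI[of _ 1])

lemma topspace_zariski_quasiprojective: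
  assumes "quasiprojective k V"
  shows "topspace (zariski_topology V) = V"
proof -
  have "P \<noteq> {}" if P: "P \<in> V" for P
  proof -
    from assms P obtain n where "P \<in> proj_space n"
      by (auto simp: quasiprojective_def zero_locus_def)
    thus ?thesis by (rule proj_space_nonempty)
  qed
  thus ?thesis by (auto simp: topspace_zariski_topology)
qed

lemma galois_act_class:
  assumes "\<sigma> \<in> galois_set"
  shows "galois_act \<sigma> {y. \<exists>c. c \<noteq> 0 \<and> y = (\<lambda>i. c * x i)} =
    {y. \<exists>c. c \<noteq> 0 \<and> y = (\<lambda>i. c * (\<sigma> \<circ> x) i)}"
proof -
  note s = galois_setD[OF assms]
  have nz: "\<sigma> c = 0 \<longleftrightarrow> c = 0" for c
    using s(1,5) by (metis bij_pointE)
  have "(\<lambda>i. c * \<sigma> (x i)) \<in> galois_act \<sigma> {y. \<exists>c. c \<noteq> 0 \<and> y = (\<lambda>i. c * x i)}"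
    if "c \<noteq> 0" for c
  proof -
    obtain b where "c = \<sigma> b" using s(1) by (metis bij_pointE)
    moreover from this have "b \<noteq> 0" using that nz by auto
    ultimately show ?thesis
      by (auto simp: galois_act_def s(3) fun_eq_iff intro!: image_eqI[of _ _ "\<lambda>i. b * x i"])
  qed
  moreover have "\<sigma> \<circ> (\<lambda>i. c * x i) = (\<lambda>i. \<sigma> c * (\<sigma> \<circ> x) i)" for c
    by (simp add: fun_eq_iff s(3))
  ultimately show ?thesis
    using nz by (fastforce simp: galois_act_def)
qed

lemma galois_act_proj_space:
  assumes \<sigma>: "\<sigma> \<in> galois_set" and P: "P \<in> proj_space n"
  shows "galois_act \<sigma> P \<in> proj_space n"
proof -
  from P obtain x where x: "x \<in> coord_vectors n" "P = {y. \<exists>c. c \<noteq> 0 \<and> y = (\<lambda>i. c * x i)}"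
    by (rule proj_spaceE)
  have "\<sigma> c = 0 \<longleftrightarrow> c = 0" for c
    using galois_setD(1,5)[OF \<sigma>] by (metis bij_pointE)
  hence "\<sigma> \<circ> x \<in> coord_vectors n" using x(1) by (auto simp: coord_vectors_def)
  thus ?thesis
    unfolding x(2) galois_act_class[OF \<sigma>]
    by (auto simp: proj_space_def quotient_def scaling_rel_def intro!: bexI[of _ "\<sigma> \<circ> x"])
qed

lemma galois_act_quasiprojective:
  assumes \<sigma>: "\<sigma> \<in> galois_set" and V: "quasiprojective base_field V" and P: "P \<in> V"
  shows "galois_act \<sigma> P \<in> V"
proof -
  have "\<sigma> c = 0 \<longleftrightarrow> c = 0" for c
    using galois_setD(1,5)[OF \<sigma>] by (metis bij_pointE)
  hence *: "vanishes_at p (galois_act \<sigma> P) \<longleftrightarrow> vanishes_at p P" if "form base_field d p" for p d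
    using galois_peval[OF \<sigma> that] by (simp add: vanishes_at_def galois_act_def)
  from V obtain n S T where ST: "\<forall>p\<in>S \<union> T. \<exists>d. form base_field d p"
    "V = zero_locus n S - zero_locus n T"
    by (auto simp: quasiprojective_def)
  have "\<forall>p\<in>S \<union> T. vanishes_at p (galois_act \<sigma> P) \<longleftrightarrow> vanishes_at p P"
    using ST(1) * by blast
  thus ?thesis
    using P galois_act_proj_space[OF \<sigma>, of P n] unfolding ST(2) zero_locus_def by auto
qed

lemma rational_points_eq:
  fixes V :: "'k::finite_field alg_closure point set"
  assumes "quasiprojective base_field V"
  shows "rational_points V = {P \<in> V. \<forall>\<sigma>\<in>galois_set. galois_act \<sigma> P = P}"
proof -
  have "(\<exists>x\<in>P. \<forall>i. x i \<in> base_field) \<longleftrightarrow> (\<forall>\<sigma>\<in>galois_set. galois_act \<sigma> P = P)" if P: "P \<in> V" for P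
  proof -
    obtain n where "P \<in> proj_space n"
      using assms P by (auto simp: quasiprojective_def zero_locus_def)
    then obtain x where x: "x \<in> coord_vectors n" "P = {y. \<exists>c. c \<noteq> 0 \<and> y = (\<lambda>i. c * x i)}"
      by (rule proj_spaceE)
    show ?thesis
    proof
      assume "\<exists>y\<in>P. \<forall>i. y i \<in> base_field"
      then obtain y c where y: "\<forall>i. y i \<in> base_field" "y = (\<lambda>i. c * x i)" "c \<noteq> 0"
        using x by auto
      have "(\<exists>b. b \<noteq> 0 \<and> z = (\<lambda>i. b * x i)) \<longleftrightarrow> (\<exists>b. b \<noteq> 0 \<and> z = (\<lambda>i. b * y i))" for z
      proof
        assume "\<exists>b. b \<noteq> 0 \<and> z = (\<lambda>i. b * x i)"
        then obtain b where "b \<noteq> 0" "z = (\<lambda>i. b * x i)" by blast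
        thus "\<exists>b. b \<noteq> 0 \<and> z = (\<lambda>i. b * y i)"
          using y(3) by (intro exI[of _ "b / c"]) (simp add: y(2))
      next
        assume "\<exists>b. b \<noteq> 0 \<and> z = (\<lambda>i. b * y i)"
        then obtain b where "b \<noteq> 0" "z = (\<lambda>i. b * y i)" by blast
        thus "\<exists>b. b \<noteq> 0 \<and> z = (\<lambda>i. b * x i)"
          using y(3) by (intro exI[of _ "b * c"]) (simp add: y(2) mult.assoc)
      qed
      hence P: "P = {z. \<exists>b. b \<noteq> 0 \<and> z = (\<lambda>i. b * y i)}"
        unfolding x(2) by blast
      show "\<forall>\<sigma>\<in>galois_set. galois_act \<sigma> P = P"
      proof
        fix \<sigma> :: "'k alg_closure \<Rightarrow> 'k alg_closure" assume \<sigma>: "\<sigma> \<in> galois_set"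
        hence "\<forall>a\<in>base_field. \<sigma> a = a" by (simp add: galois_set_def)
        hence "\<sigma> \<circ> y = y" using y(1) by (metis comp_apply ext)
        thus "galois_act \<sigma> P = P" unfolding P galois_act_class[OF \<sigma>] by simp
      qed
    next
      assume fixed: "\<forall>\<sigma>\<in>galois_set. galois_act \<sigma> P = P"
      obtain j where j: "x j \<noteq> 0" using x(1) by (auto simp: coord_vectors_def)
      define y where "y = (\<lambda>i. inverse (x j) * x i)"
      have y: "y \<in> P" "y j = 1" using j by (auto simp: x(2) y_def intro!: exI[of _ "inverse (x j)"])
      have "y i \<in> base_field" for i
      proof (rule galois_fixed_field, rule ballI)
        fix \<sigma> :: "'k alg_closure \<Rightarrow> 'k alg_closure" assume \<sigma>: "\<sigma> \<in> galois_set"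
        have "\<sigma> \<circ> y \<in> P" using fixed \<sigma> y(1) unfolding galois_act_def by blast
        then obtain c where c: "\<sigma> \<circ> y = (\<lambda>i. c * x i)" using x(2) by auto
        have "c * x j = 1" using fun_cong[OF c, of j] y(2) galois_setD(6)[OF \<sigma>] by simp
        hence "c = inverse (x j)" using j by (simp add: field_simps)
        thus "\<sigma> (y i) = y i" using fun_cong[OF c, of i] by (simp add: y_def)
      qed
      thus "\<exists>x\<in>P. \<forall>i. x i \<in> base_field" using y(1) by blast
    qed
  qed
  thus ?thesis by (auto simp: rational_points_def)
qed

theorem twist_rational_points:
  fixes V :: "'k::finite_field alg_closure point set"
  assumes V: "quasiprojective base_field V" and G: "subgroup G (aut_group base_field V)"
    and \<xi>: "\<xi> \<in> H1 V G" and tw: "is_twist V \<xi> V' \<psi>"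
  shows "\<psi> ` {Q \<in> V. \<forall>\<sigma>\<in>galois_set. Q = \<xi> \<sigma> (galois_act \<sigma> Q)} = rational_points V'"
proof -
  have bij: "bij_betw \<psi> V V'" and V': "quasiprojective base_field V'"
    and coc: "\<And>\<sigma> Q. \<sigma> \<in> galois_set \<Longrightarrow> Q \<in> V \<Longrightarrow> galois_act \<sigma> (\<psi> Q) = \<psi> (\<xi> \<sigma> (galois_act \<sigma> Q))"
    using tw by (auto simp: is_twist_def isomorphism_def)
  have mem: "\<xi> \<sigma> (galois_act \<sigma> Q) \<in> V" if "\<sigma> \<in> galois_set" "Q \<in> V" for \<sigma> Q
  proof -
    have "\<xi> \<sigma> \<in> G" using \<xi> that(1) by (auto simp: H1_def hom_def galois_group_def)
    hence "\<xi> \<sigma> \<in> Bij V" using subgroup.subset[OF G] by (auto simp: aut_group_def)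
    thus ?thesis
      using Bij_imp_funcset galois_act_quasiprojective[OF that(1) V that(2)] by blast
  qed
  have "(\<forall>\<sigma>\<in>galois_set. Q = \<xi> \<sigma> (galois_act \<sigma> Q)) \<longleftrightarrow>
      (\<forall>\<sigma>\<in>galois_set. galois_act \<sigma> (\<psi> Q) = \<psi> Q)" if "Q \<in> V" for Q
    using coc[OF _ that] mem[OF _ that] that bij by (metis bij_betw_def inj_on_eq_iff)
  moreover have "V' = \<psi> ` V" using bij by (simp add: bij_betw_def)
  ultimately show ?thesis
    unfolding rational_points_eq[OF V'] by auto
qed

end

(*
  Let F be the q-power Frobenius. It topologically generates the Galois group, which is the
  profinite completion of the integers: on every finite set of elements each automorphism agrees
  with a power of F. Hence a continuous homomorphism xi into G is the same thing as the element
  xi(F) of G, and Q corresponds to a rational point of the twist by xi iff Q = xi(F)(F(Q)).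
  The right-hand sum therefore counts the pairs (g, Q) with Q periodic and Q = g(F(Q)). Such a Q
  lies over a rational point of the quotient, and conversely the fibre over a rational point is a
  single orbit stable under F, on which (G being abelian) there are exactly |G| such pairs. Finally,
  Q is periodic iff its image is: if phi^n(Q) = g(Q), then phi^(n|G|)(Q) = Q.
*)

theory Submission
  imports Defs
begin

section \<open>The Frobenius automorphism\<close>

definition frob :: "'k::finite_field alg_closure \<Rightarrow> 'k alg_closure" where
  "frob x = x ^ CARD('k)"

lemma frob_in_galois_set: "frob \<in> galois_set"
  using frobenius_in_galois_set by (simp add: frob_def[abs_def])

lemma funpow_frob: "(frob ^^ n) (x :: 'k::finite_field alg_closure) = x ^ (CARD('k) ^ n)"
  by (induction n) (simp_all add: frob_def power_mult mult.commute flip: power_mult)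

lemma galois_set_comp: "\<sigma> \<in> galois_set \<Longrightarrow> \<tau> \<in> galois_set \<Longrightarrow> \<sigma> \<circ> \<tau> \<in> galois_set"
  by (auto simp: galois_set_def intro: bij_comp)

lemma funpow_galois_set: "\<sigma> \<in> galois_set \<Longrightarrow> \<sigma> ^^ n \<in> galois_set"
  by (induction n) (auto intro: galois_set_comp, simp add: galois_set_def)

lemma galois_power: "\<sigma> \<in> galois_set \<Longrightarrow> \<sigma> (x ^ n) = \<sigma> x ^ n"
  by (induction n) (auto simp: galois_setD)

lemma galois_commutes_frob:
  "\<sigma> \<in> galois_set \<Longrightarrow> \<sigma> ((frob ^^ n) x) = (frob ^^ n) (\<sigma> (x :: 'k::finite_field alg_closure))"
  by (simp add: funpow_frob galois_power)

lemma galois_poly: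
  assumes \<sigma>: "\<sigma> \<in> galois_set"
  shows "\<sigma> (poly p x) = poly (map_poly \<sigma> p) (\<sigma> x)"
proof (induction p)
  case 0
  then show ?case using galois_setD[OF \<sigma>] by simp
next
  case (pCons a p)
  then show ?case using galois_setD[OF \<sigma>] by (simp add: map_poly_pCons)
qed

lemma galois_poly_base_field:
  assumes \<sigma>: "\<sigma> \<in> galois_set" and p: "\<forall>i. coeff p i \<in> base_field"
  shows "\<sigma> (poly p x) = poly p (\<sigma> x)"
proof -
  have "map_poly \<sigma> p = p"
    using p galois_setD[OF \<sigma>] by (intro poly_eqI) (metis coeff_map_poly rangeE)
  thus ?thesis using galois_poly[OF \<sigma>] by simp
qed

text \<open>All iterates of \<open>x\<close> under Frobenius are roots of one polynomial over the
  finite field, so two of them coincide. Injectivity of Frobenius then cancels the smaller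
  exponent.\<close>

lemma ex_frob_period:
  fixes x :: "'k::finite_field alg_closure"
  shows "\<exists>n>0. (frob ^^ n) x = x"
proof -
  obtain p :: "'k poly" where p: "p \<noteq> 0" "poly (map_poly to_ac p) x = 0"
    by (rule alg_closure_algebraic)
  let ?p = "map_poly to_ac p"
  have "poly ?p ((frob ^^ n) x) = 0" for n
  proof -
    have F: "(frob ^^ n :: 'k alg_closure \<Rightarrow> _) \<in> galois_set"
      by (rule funpow_galois_set[OF frob_in_galois_set])
    show ?thesis
      using galois_poly_base_field[OF F, of ?p x] galois_setD(5)[OF F] p(2)
      by (simp add: coeff_map_poly)
  qed
  hence "range (\<lambda>n. (frob ^^ n) x) \<subseteq> {y. poly ?p y = 0}" by auto
  moreover have "?p \<noteq> 0" using p(1) by (auto simp: poly_eq_iff coeff_map_poly)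
  ultimately have "finite (range (\<lambda>n. (frob ^^ n) x))"
    using poly_roots_finite finite_subset by blast
  then obtain m n where mn: "(frob ^^ m) x = (frob ^^ n) x" "m < n"
    by (metis finite_imageD infinite_UNIV_nat linorder_inj_onI' linorder_less_linear)
  have "inj (frob ^^ m :: 'k alg_closure \<Rightarrow> _)"
    using funpow_galois_set[OF frob_in_galois_set] galois_setD(1) bij_is_inj by blast
  moreover have "(frob ^^ m) ((frob ^^ (n - m)) x) = (frob ^^ m) x"
    using mn by (simp flip: funpow_add o_apply[of "frob ^^ m"])
  ultimately show ?thesis using mn(2) by (intro exI[of _ "n - m"]) (auto dest: injD)
qed

lemma funpow_mult_fixed: "(f ^^ n) x = x \<Longrightarrow> (f ^^ (n * k)) x = x"
  using funpow_mod_eq[of n f x "n * k"] by simp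

lemma ex_common_frob_period:
  fixes S :: "'k::finite_field alg_closure set"
  assumes "finite S"
  shows "\<exists>n>0. \<forall>x\<in>S. (frob ^^ n) x = x"
  using assms
proof induction
  case (insert x S)
  then obtain n where n: "n > 0" "\<forall>x\<in>S. (frob ^^ n) x = x" by blast
  obtain m where m: "m > 0" "(frob ^^ m) x = x" using ex_frob_period by blast
  show ?case
    using n m funpow_mult_fixed[of n frob _ m] funpow_mult_fixed[of m frob _ n]
    by (intro exI[of _ "n * m"]) (auto simp: mult.commute)
qed auto

section \<open>Finite subfields as fixed sets of Frobenius powers\<close>

definition frob_fixed :: "nat \<Rightarrow> 'k::finite_field alg_closure set" where
  "frob_fixed n = {x. (frob ^^ n) x = x}"

text \<open>Translation by 1 permutes the field, so adding 1 to every element leaves the sum of all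
  elements unchanged.\<close>

lemma of_nat_card_finite_field: "of_nat CARD('k) = (0 :: 'k::finite_field)"
proof -
  have "(\<Sum>x\<in>UNIV. x + 1) = (\<Sum>x\<in>UNIV. x :: 'k)"
    by (rule sum.reindex_bij_witness[of _ "\<lambda>x. x - 1" "\<lambda>x. x + 1"]) auto
  thus ?thesis by (simp add: sum.distrib)
qed

lemma card_finite_field_ge_2: "CARD('k::finite_field) \<ge> 2"
  using card_mono[of UNIV "{0, 1 :: 'k}"] by simp

text \<open>Over an algebraically closed field the multiset of roots has size equal to the degree. A
  root of multiplicity at least 2 would also be a root of the derivative, so every multiplicity is
  1.\<close>

lemma card_roots_separable:
  fixes p :: "'a::alg_closed_field poly"
  assumes p: "p \<noteq> 0" and sep: "\<And>x. poly p x = 0 \<Longrightarrow> poly (pderiv p) x \<noteq> 0"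
  shows "card {x. poly p x = 0} = Polynomial.degree p"
proof -
  obtain A where A: "size A = Polynomial.degree p"
      "p = smult (lead_coeff p) (\<Prod>x\<in>#A. [:-x, 1:])"
    using alg_closed_imp_factorization[OF p] by blast
  have "proots (\<Prod>x\<in>#A. [:-x, 1:]) = A"
  proof (induction A)
    case (add x A)
    have "(\<Prod>x\<in>#A. [:-x, 1:]) \<noteq> (0 :: 'a poly)" by (auto simp: prod_mset_zero_iff)
    thus ?case using add by (simp add: proots_mult del: mult_pCons_left)
  qed simp
  hence "proots p = A" using p A(2) by (metis leading_coeff_0_iff proots_smult)
  hence "size (proots p) = Polynomial.degree p" using A(1) by simp
  moreover have "count (proots p) x = 1" if "x \<in># proots p" for x
  proof -
    have root: "poly p x = 0" using that p by simp
    have "Polynomial.order x p < 2"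
    proof (rule ccontr)
      assume "\<not> Polynomial.order x p < 2"
      moreover define l where "l = [:-x, 1:]"
      ultimately have "l ^ 2 dvd p" using p unfolding order_divides l_def by simp
      then obtain r where "p = l ^ 2 * r" by (rule dvdE)
      moreover have "poly l x = 0" by (simp add: l_def)
      ultimately have "poly (pderiv p) x = 0" by (simp add: pderiv_mult power2_eq_square)
      thus False using sep[OF root] by contradiction
    qed
    thus ?thesis using root p order_root[of p x] by simp
  qed
  hence "size (proots p) = card (set_mset (proots p))"
    by (simp add: size_multiset_overloaded_eq)
  ultimately show ?thesis using p by simp
qed

text \<open>With q = \<open>CARD('k)\<close>, the set consists of the roots of X^(q^n) - X. Its
  derivative is -1 because q vanishes in the field, so the roots are distinct. For
  \<open>n = 0\<close> the set would be the whole closure.\<close>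

lemma
  assumes "n > 0"
  shows finite_frob_fixed: "finite (frob_fixed n :: 'k::finite_field alg_closure set)"
    and card_frob_fixed: "card (frob_fixed n :: 'k alg_closure set) = CARD('k) ^ n"
proof -
  let ?q = "CARD('k) ^ n"
  have q: "?q > 1" using assms card_finite_field_ge_2[where 'k='k]
    by (intro one_less_power) auto
  define f :: "'k alg_closure poly" where "f = Polynomial.monom 1 ?q - Polynomial.monom 1 1"
  have roots: "{x. poly f x = 0} = frob_fixed n"
    by (simp add: f_def poly_monom frob_fixed_def funpow_frob)
  have deg: "Polynomial.degree f = ?q"
    unfolding f_def diff_conv_add_uminus using q
    by (subst degree_add_eq_left) (auto simp: degree_monom_eq)
  hence nz: "f \<noteq> 0" using q by auto
  have "of_nat CARD('k) = (0 :: 'k alg_closure)"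
    using of_nat_card_finite_field[where 'k='k] by (simp flip: to_ac_of_nat)
  hence "pderiv f = [:-1:]" using assms
    by (simp add: f_def pderiv_diff pderiv_monom monom_0 one_pCons power_0_left)
  hence "card {x. poly f x = 0} = Polynomial.degree f"
    by (intro card_roots_separable nz) simp
  thus "finite (frob_fixed n :: 'k alg_closure set)" "card (frob_fixed n :: 'k alg_closure set) = ?q"
    using poly_roots_finite[OF nz] deg by (simp_all add: roots)
qed

text \<open>A closure with N elements would contain \<open>frob_fixed N\<close>, which has at least
  2^N > N elements.\<close>

lemma infinite_alg_closure_finite_field: "infinite (UNIV :: 'k::finite_field alg_closure set)"
proof
  assume fin: "finite (UNIV :: 'k alg_closure set)"
  let ?N = "CARD('k alg_closure)"
  have "?N > 0" using fin by (simp add: card_gt_0_iff)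
  hence "CARD('k) ^ ?N \<le> ?N"
    using card_mono[OF fin, of "frob_fixed ?N"] card_frob_fixed by (metis subset_UNIV)
  moreover have "?N < 2 ^ ?N" by (rule less_exp)
  ultimately show False
    using power_mono[of 2 "CARD('k)" ?N] card_finite_field_ge_2[where 'k='k] by linarith
qed

lemma fixed_by_frob_in_base_field:
  fixes x :: "'k::finite_field alg_closure"
  assumes "frob x = x"
  shows "x \<in> base_field"
proof -
  have "frob (to_ac a) = to_ac a" for a :: 'k
    using galois_setD(4)[OF frob_in_galois_set] .
  hence "base_field \<subseteq> (frob_fixed 1 :: 'k alg_closure set)" by (auto simp: frob_fixed_def)
  moreover have "card (base_field :: 'k alg_closure set) = card (frob_fixed 1 :: 'k alg_closure set)"
    by (simp add: card_image inj_to_ac card_frob_fixed)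
  ultimately have "base_field = (frob_fixed 1 :: 'k alg_closure set)"
    by (intro card_subset_eq finite_frob_fixed) auto
  thus ?thesis using assms by (simp add: frob_fixed_def)
qed

text \<open>Frobenius has order exactly \<open>n\<close> on the field with q^n elements: if the
  residues differed, cancelling the smaller one would leave a power with exponent
  \<open>d < n\<close> that is trivial on this field, yet such a power fixes only q^d
  elements.\<close>

lemma frob_funpow_eq_imp_cong:
  assumes n: "n > 0" and eq: "\<forall>x\<in>frob_fixed n. (frob ^^ i) x = (frob ^^ j) (x :: 'k::finite_field alg_closure)"
  shows "i mod n = j mod n"
proof -
  have *: "j mod n \<le> i mod n"
    if eq: "\<forall>x\<in>frob_fixed n. (frob ^^ i) x = (frob ^^ j) (x :: 'k alg_closure)" for i j
  proof (rule ccontr)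
    assume "\<not> j mod n \<le> i mod n"
    hence lt: "i mod n < j mod n" by simp
    let ?d = "j mod n - i mod n"
    have "x \<in> frob_fixed ?d" if x: "x \<in> frob_fixed n" for x :: "'k alg_closure"
    proof -
      have "(frob ^^ (i mod n)) x = (frob ^^ (j mod n)) x"
        using eq x by (simp add: frob_fixed_def funpow_mod_eq)
      also have "\<dots> = (frob ^^ (i mod n)) ((frob ^^ ?d) x)"
        using lt by (simp flip: funpow_add o_apply[of "frob ^^ (i mod n)"])
      finally show ?thesis
        using bij_is_inj[OF galois_setD(1)[OF funpow_galois_set[OF frob_in_galois_set]], of "i mod n"]
        by (auto simp: frob_fixed_def dest!: injD)
    qed
    hence "frob_fixed n \<subseteq> (frob_fixed ?d :: 'k alg_closure set)" by blast
    hence "CARD('k) ^ n \<le> CARD('k) ^ ?d"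
      using card_mono[OF finite_frob_fixed] card_frob_fixed n lt by (metis zero_less_diff)
    moreover have "?d < n" using n by (meson less_imp_diff_less mod_less_divisor)
    ultimately show False
      using card_finite_field_ge_2[where 'k='k] power_strict_increasing[of ?d n "CARD('k)"] by simp
  qed
  show ?thesis using *[of i j] *[of j i] eq by simp
qed

text \<open>The multiplicative group of a finite field is cyclic. The subfield is packaged as a ring
  record so that this theorem about \<open>field\<close> structures applies.\<close>

lemma frob_fixed_generator:
  assumes n: "n > 0"
  shows "\<exists>a\<in>frob_fixed n. \<forall>x\<in>frob_fixed n - {0 :: 'k::finite_field alg_closure}. \<exists>i. x = a ^ i"
proof -
  let ?K = "frob_fixed n :: 'k alg_closure set"
  define R :: "'k alg_closure ring" where
    "R = \<lparr>carrier = ?K, monoid.mult = (*), one = 1, ring.zero = 0, add = (+)\<rparr>"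
  have F: "(frob ^^ n :: 'k alg_closure \<Rightarrow> _) \<in> galois_set"
    by (rule funpow_galois_set[OF frob_in_galois_set])
  note s = galois_setD[OF F]
  have closed: "0 \<in> ?K" "1 \<in> ?K" "\<And>x y. x \<in> ?K \<Longrightarrow> y \<in> ?K \<Longrightarrow> x + y \<in> ?K"
      "\<And>x y. x \<in> ?K \<Longrightarrow> y \<in> ?K \<Longrightarrow> x * y \<in> ?K"
    by (simp_all add: frob_fixed_def s)
  have R: "carrier R = ?K" "\<And>x y. x \<otimes>\<^bsub>R\<^esub> y = x * y" "\<And>x y. x \<oplus>\<^bsub>R\<^esub> y = x + y"
      "\<one>\<^bsub>R\<^esub> = 1" "\<zero>\<^bsub>R\<^esub> = 0"
    by (simp_all add: R_def)
  have "cring R"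
  proof (rule cringI)
    have "- x \<in> ?K" if "x \<in> ?K" for x
      using s(2)[of x "- x"] s(5) that by (simp add: frob_fixed_def eq_neg_iff_add_eq_0 add.commute)
    hence "\<exists>y\<in>?K. y + x = 0" if "x \<in> ?K" for x
      using that by (intro bexI[of _ "- x"]) simp_all
    thus "abelian_group R"
      by (intro abelian_groupI) (simp_all add: R closed add_ac)
    show "comm_monoid R"
      by (intro comm_monoidI) (simp_all add: R closed mult_ac)
  qed (simp add: R distrib_right)
  moreover have "Units R = carrier R - {\<zero>\<^bsub>R\<^esub>}"
  proof (intro equalityI subsetI)
    fix x assume "x \<in> Units R"
    thus "x \<in> carrier R - {\<zero>\<^bsub>R\<^esub>}" by (auto simp: Units_def R)
  next
    fix x assume "x \<in> carrier R - {\<zero>\<^bsub>R\<^esub>}"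
    hence x: "x \<in> ?K" "x \<noteq> 0" by (simp_all add: R)
    \<comment> \<open>Iterated Frobenius is a power map, so it commutes with inverses.\<close>
    hence "inverse x \<in> ?K" by (simp add: frob_fixed_def funpow_frob power_inverse)
    thus "x \<in> Units R"
      unfolding Units_def R mem_Collect_eq using x by (intro conjI bexI[of _ "inverse x"]) simp_all
  qed
  ultimately have "field R" by (rule cring.cring_fieldI)
  interpret R: field R by fact
  have "finite (carrier R)" unfolding R by (rule finite_frob_fixed[OF n])
  from R.finite_field_mult_group_has_gen[OF this] obtain a where
    a: "a \<in> carrier (Multiplicative_Group.mult_of R)"
      "carrier (Multiplicative_Group.mult_of R) = {a [^]\<^bsub>R\<^esub> i |i::nat. i \<in> UNIV}"
    by (elim bexE)
  have pow: "b [^]\<^bsub>R\<^esub> i = b ^ i" for b and i :: nat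
    by (induction i) (simp_all add: R)
  show ?thesis
  proof (intro bexI[of _ a] ballI)
    show "a \<in> frob_fixed n" using a(1) by (simp add: R)
    fix x assume "x \<in> ?K - {0}"
    hence "x \<in> carrier (Multiplicative_Group.mult_of R)" by (simp add: R)
    thus "\<exists>i. x = a ^ i" unfolding a(2) pow mem_Collect_eq by (elim exE conjE) (rule exI)
  qed
qed

text \<open>The finite set lies in a finite subfield, whose multiplicative group has a generator
  \<open>a\<close>. If \<open>\<sigma> a\<close> is a Frobenius conjugate
  \<open>(frob ^^ m) a\<close>, then the two automorphisms agree on all powers of \<open>a\<close>
  and at 0, hence on the subfield.\<close>

lemma galois_eq_frob_on_finite:
  fixes S :: "'k::finite_field alg_closure set"
  assumes \<sigma>: "\<sigma> \<in> galois_set" and S: "finite S"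
  shows "\<exists>m. \<forall>x\<in>S. \<sigma> x = (frob ^^ m) x"
proof -
  have "\<exists>n>0. S \<subseteq> frob_fixed n"
    using ex_common_frob_period[OF S] unfolding frob_fixed_def subset_iff mem_Collect_eq Ball_def .
  then obtain n where n: "n > 0" "S \<subseteq> frob_fixed n" by (elim exE conjE)
  from frob_fixed_generator[OF n(1)] obtain a :: "'k alg_closure"
    where a: "a \<in> frob_fixed n" "\<forall>x\<in>frob_fixed n - {0}. \<exists>i. x = a ^ i"
    by (rule bexE)
  \<comment> \<open>Frobenius permutes the factors of this product, so its coefficients lie in
    \<open>base_field\<close> and \<open>\<sigma>\<close> must send the root \<open>a\<close> to
    another root.\<close>
  define f where "f = (\<Prod>i<n. [:- (frob ^^ i) a, 1:])"
  have F: "(frob :: 'k alg_closure \<Rightarrow> _) \<in> galois_set"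
    by (rule frob_in_galois_set)
  note fr = galois_setD[OF F]
  obtain k where k: "n = Suc k" using n(1) gr0_conv_Suc by auto
  have frob_poly: "frob (poly f x) = poly f (frob x)" for x
  proof -
    have diff: "frob (x - y) = frob x - frob y" for x y :: "'k alg_closure"
      using fr(2)[of "x - y" y] by simp
    have prod: "frob (prod g A) = (\<Prod>i\<in>A. frob (g i))" for g :: "nat \<Rightarrow> 'k alg_closure" and A
      by (induction A rule: infinite_finite_induct) (simp_all add: fr)
    have "frob (poly f x) = (\<Prod>i<n. frob x - (frob ^^ Suc i) a)"
      by (simp add: diff f_def poly_prod prod)
    \<comment> \<open>The last factor wraps around: \<open>(frob ^^ n) a\<close> is \<open>a\<close>
      again because \<open>a\<close> lies in \<open>frob_fixed n\<close>.\<close>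
    also have "\<dots> = (\<Prod>i<k. frob x - (frob ^^ Suc i) a) * (frob x - a)"
      using a(1) by (simp add: frob_fixed_def k)
    also have "\<dots> = (\<Prod>i<n. frob x - (frob ^^ i) a)"
      unfolding k prod.lessThan_Suc_shift by (simp add: mult.commute)
    also have "\<dots> = poly f (frob x)" by (simp add: f_def poly_prod)
    finally show ?thesis .
  qed
  \<comment> \<open>Every \<open>y\<close> is some \<open>frob x\<close>, so \<open>f\<close> and
    its Frobenius conjugate take the same value everywhere. Over an infinite field this forces equal
    coefficients.\<close>
  have "poly (map_poly frob f - f) y = 0" for y
  proof -
    obtain x where "y = frob x" using bij_is_surj[OF fr(1)] by (rule surjE)
    thus ?thesis using frob_poly[of x] galois_poly[OF F, of f x] by simp
  qed
  hence "{x. poly (map_poly frob f - f) x = 0} = UNIV" by (simp only: simp_thms UNIV_def)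
  hence "map_poly frob f - f = 0"
    using infinite_alg_closure_finite_field[where 'k='k] poly_roots_finite[of "map_poly frob f - f"]
    by metis
  hence "coeff (map_poly frob f) j = coeff f j" for j by simp
  hence "coeff f j \<in> base_field" for j
    using fr(5) by (intro fixed_by_frob_in_base_field) (simp add: coeff_map_poly)
  hence "poly f (\<sigma> a) = \<sigma> (poly f a)"
    using galois_poly_base_field[OF \<sigma>] by simp
  also have "poly f a = 0"
    unfolding f_def poly_prod by (rule prod_zero[OF _ bexI[of _ 0]]) (use n(1) in auto)
  finally have "poly f (\<sigma> a) = 0" using galois_setD(5)[OF \<sigma>] by simp
  then obtain m where m: "\<sigma> a = (frob ^^ m) a" by (auto simp: f_def poly_prod)
  have Fm: "(frob ^^ m :: 'k alg_closure \<Rightarrow> _) \<in> galois_set"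
    by (rule funpow_galois_set[OF F])
  have "\<sigma> x = (frob ^^ m) x" if x: "x \<in> S" for x
  proof (cases "x = 0")
    case True
    then show ?thesis using galois_setD(5)[OF \<sigma>] galois_setD(5)[OF Fm] by simp
  next
    case False
    hence "x \<in> frob_fixed n - {0}" using n(2) x by auto
    with a(2) have "\<exists>i. x = a ^ i" by (rule bspec)
    then obtain i where "x = a ^ i" by (rule exE)
    then show ?thesis
      using m by (simp add: galois_power[OF \<sigma>] galois_power[OF Fm])
  qed
  thus ?thesis by (intro exI[of _ m] ballI)
qed

section \<open>Continuous homomorphisms from the Galois group\<close>

lemma openin_krull_cylinder:
  assumes "\<sigma> \<in> galois_set" "finite S"
  shows "openin krull_topology {\<tau> \<in> galois_set. \<forall>x\<in>S. \<tau> x = \<sigma> x}"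
  unfolding krull_topology_def using assms by (intro topology_generated_by_Basis) blast

lemma topspace_krull: "topspace krull_topology = galois_set"
proof (rule equalityI)
  show "topspace krull_topology \<subseteq> galois_set"
    unfolding krull_topology_def topology_generated_by_topspace by auto
  have "id \<in> galois_set" by (simp add: galois_set_def)
  hence "openin krull_topology {\<tau> \<in> galois_set. \<forall>x\<in>{}. \<tau> x = id x}"
    by (rule openin_krull_cylinder[OF _ finite.emptyI])
  thus "galois_set \<subseteq> topspace krull_topology"
    using openin_subset by auto
qed

text \<open>Agreement with \<open>\<sigma>\<close> on finite sets gives a neighbourhood base at
  \<open>\<sigma>\<close>: a binary intersection takes the union of the two finite sets, and a basic
  open set around \<open>\<rho>\<close> that contains \<open>\<sigma>\<close> can be recentred at
  \<open>\<sigma>\<close>.\<close>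

lemma openin_krull_nbhd:
  assumes "openin krull_topology U" "\<sigma> \<in> U"
  shows "\<exists>S. finite S \<and> (\<forall>\<tau>\<in>galois_set. (\<forall>x\<in>S. \<tau> x = \<sigma> x) \<longrightarrow> \<tau> \<in> U)"
proof -
  have "generate_topology_on {{\<tau> \<in> galois_set. \<forall>x\<in>S. \<tau> x = \<sigma> x} |\<sigma> S. \<sigma> \<in> galois_set \<and> finite S} U"
    using assms(1) by (simp add: krull_topology_def openin_topology_generated_by_iff)
  thus ?thesis using assms(2)
  proof induction
    case (Int U1 U2)
    hence U: "\<sigma> \<in> U1" "\<sigma> \<in> U2" by simp_all
    from Int.IH(1)[OF U(1)] obtain S1 where S1:
      "finite S1" "\<forall>\<tau>\<in>galois_set. (\<forall>x\<in>S1. \<tau> x = \<sigma> x) \<longrightarrow> \<tau> \<in> U1"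
      by (elim exE conjE)
    from Int.IH(2)[OF U(2)] obtain S2 where S2:
      "finite S2" "\<forall>\<tau>\<in>galois_set. (\<forall>x\<in>S2. \<tau> x = \<sigma> x) \<longrightarrow> \<tau> \<in> U2"
      by (elim exE conjE)
    from S1 S2 show ?case by (intro exI[of _ "S1 \<union> S2"]) auto
  next
    case (UN K)
    then obtain U where U: "U \<in> K" "\<sigma> \<in> U" by (elim UnionE)
    with UN(2) obtain S where "finite S" "\<forall>\<tau>\<in>galois_set. (\<forall>x\<in>S. \<tau> x = \<sigma> x) \<longrightarrow> \<tau> \<in> U"
      by meson
    then show ?case using U by (intro exI[of _ S]) auto
  next
    case (Basis U)
    then obtain \<rho> S where "finite S" "U = {\<tau> \<in> galois_set. \<forall>x\<in>S. \<tau> x = \<rho> x}"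
      unfolding mem_Collect_eq by (elim exE conjE)
    then show ?case using Basis(2) by (intro exI[of _ S]) simp
  qed simp
qed

text \<open>The shape of \<open>H1\<close> for an arbitrary discrete target group, so that these
  homomorphisms can be classified inside the locale \<open>group\<close>; \<open>H1_eq\<close> makes
  the link.\<close>

definition continuous_homs ::
  "('g, 'm) monoid_scheme \<Rightarrow> (('k::field alg_closure \<Rightarrow> 'k alg_closure) \<Rightarrow> 'g) set" where
  "continuous_homs A = {\<xi> \<in> hom galois_group A \<inter> extensional galois_set.
     continuous_map krull_topology (discrete_topology (carrier A)) \<xi>}"

text \<open>Singletons are open in the discrete target, so the fibre of \<open>\<xi>\<close> through
  \<open>\<sigma>\<close> is an open neighbourhood of \<open>\<sigma>\<close>.\<close>

lemma continuous_hom_locally_constant: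
  assumes \<xi>: "\<xi> \<in> continuous_homs A" and \<sigma>: "\<sigma> \<in> galois_set"
  shows "\<exists>S. finite S \<and> (\<forall>\<tau>\<in>galois_set. (\<forall>x\<in>S. \<tau> x = \<sigma> x) \<longrightarrow> \<xi> \<tau> = \<xi> \<sigma>)"
proof -
  have "\<xi> \<sigma> \<in> carrier A"
    using \<xi> \<sigma> by (auto simp: continuous_homs_def hom_def galois_group_def)
  hence "openin (discrete_topology (carrier A)) {\<xi> \<sigma>}" by simp
  hence "openin krull_topology {\<tau> \<in> topspace krull_topology. \<xi> \<tau> \<in> {\<xi> \<sigma>}}"
    using \<xi> by (intro openin_continuous_map_preimage) (auto simp: continuous_homs_def)
  from openin_krull_nbhd[OF this, of \<sigma>] \<sigma> show ?thesis by (auto simp: topspace_krull)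
qed

section \<open>Continuous homomorphisms and their value at Frobenius\<close>

lemma (in group) galois_hom_funpow:
  assumes \<xi>: "\<xi> \<in> hom galois_group G" and \<sigma>: "\<sigma> \<in> galois_set"
  shows "\<xi> (\<sigma> ^^ m) = \<xi> \<sigma> [^] m"
proof (induction m)
  case 0
  have mult: "\<xi> (\<rho> \<circ> \<tau>) = \<xi> \<rho> \<otimes> \<xi> \<tau>" if "\<rho> \<in> galois_set" "\<tau> \<in> galois_set" for \<rho> \<tau>
    using \<xi> that by (auto simp: hom_def galois_group_def)
  have "id \<in> galois_set" by (simp add: galois_set_def)
  moreover from this have "\<xi> id \<in> carrier G" using \<xi> by (auto simp: hom_def galois_group_def)
  \<comment> \<open>An idempotent of a group is its unit.\<close>
  ultimately have "\<xi> id = \<one>" using mult[of id id] by simp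
  thus ?case unfolding funpow.simps(1) nat_pow_0 .
next
  case (Suc m)
  have "\<xi> (\<sigma> ^^ m \<circ> \<sigma>) = \<xi> (\<sigma> ^^ m) \<otimes> \<xi> \<sigma>"
    using \<xi> \<sigma> funpow_galois_set[OF \<sigma>] by (auto simp: hom_def galois_group_def)
  thus ?case using Suc unfolding funpow_Suc_right nat_pow_Suc by (simp only:)
qed

text \<open>One exponent serves two purposes: \<open>S\<close> is enlarged by a finite set that
  determines \<open>\<xi>\<close> near \<open>\<sigma>\<close>, so a Frobenius power agreeing with
  \<open>\<sigma>\<close> on the union also computes \<open>\<xi> \<sigma>\<close>.\<close>

lemma (in group) continuous_hom_via_frob:
  fixes \<xi> :: "('k::finite_field alg_closure \<Rightarrow> 'k alg_closure) \<Rightarrow> 'a"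
  assumes \<xi>: "\<xi> \<in> continuous_homs G" and \<sigma>: "\<sigma> \<in> galois_set" and S: "finite S"
  shows "\<exists>m. (\<forall>x\<in>S. \<sigma> x = (frob ^^ m) x) \<and> \<xi> \<sigma> = \<xi> frob [^] m"
proof -
  obtain T where T: "finite T" "\<And>\<tau>. \<tau> \<in> galois_set \<Longrightarrow> (\<forall>x\<in>T. \<tau> x = \<sigma> x) \<Longrightarrow> \<xi> \<tau> = \<xi> \<sigma>"
    using continuous_hom_locally_constant[OF \<xi> \<sigma>] by blast
  obtain m where m: "\<forall>x\<in>S \<union> T. \<sigma> x = (frob ^^ m) x"
    using galois_eq_frob_on_finite[OF \<sigma>, of "S \<union> T"] S T(1) by blast
  have "\<xi> (frob ^^ m) = \<xi> \<sigma>"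
    using m by (intro T(2) funpow_galois_set frob_in_galois_set) auto
  moreover have "\<xi> (frob ^^ m) = \<xi> frob [^] m"
    using \<xi> by (intro galois_hom_funpow frob_in_galois_set) (auto simp: continuous_homs_def)
  ultimately show ?thesis using m by auto
qed

text \<open>Injectivity holds because each value is a power of the value at Frobenius. For
  surjectivity, with N the group order, \<open>g\<close> is hit by the map sending
  \<open>\<sigma>\<close> to the \<open>m\<close>-th power of \<open>g\<close>, where
  \<open>\<sigma>\<close> acts as \<open>frob ^^ m\<close> on \<open>frob_fixed N\<close>.\<close>

lemma (in group) bij_betw_continuous_homs:
  assumes fin: "finite (carrier G)"
  shows "bij_betw (\<lambda>\<xi>. \<xi> frob)
    (continuous_homs G :: (('k::finite_field alg_closure \<Rightarrow> 'k alg_closure) \<Rightarrow> 'a) set) (carrier G)"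
proof (rule bij_betw_imageI)
  let ?H = "continuous_homs G :: (('k alg_closure \<Rightarrow> 'k alg_closure) \<Rightarrow> 'a) set"
  show "inj_on (\<lambda>\<xi>. \<xi> frob) ?H"
  proof (rule inj_onI)
    fix \<xi> \<eta> assume \<xi>: "\<xi> \<in> ?H" and \<eta>: "\<eta> \<in> ?H" and eq: "\<xi> frob = \<eta> frob"
    have "\<xi> \<sigma> = \<eta> \<sigma>" if \<sigma>: "\<sigma> \<in> galois_set" for \<sigma>
    proof -
      obtain S where S: "finite S" "\<And>\<tau>. \<tau> \<in> galois_set \<Longrightarrow> (\<forall>x\<in>S. \<tau> x = \<sigma> x) \<Longrightarrow> \<xi> \<tau> = \<xi> \<sigma>"
        using continuous_hom_locally_constant[OF \<xi> \<sigma>] by blast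
      \<comment> \<open>The finite set \<open>S\<close> was chosen for \<open>\<xi>\<close>, so the
        exponent obtained for \<open>\<eta>\<close> is valid for both.\<close>
      obtain m where m: "\<forall>x\<in>S. \<sigma> x = (frob ^^ m) x" "\<eta> \<sigma> = \<eta> frob [^] m"
        using continuous_hom_via_frob[OF \<eta> \<sigma> S(1)] by blast
      have "\<xi> \<sigma> = \<xi> (frob ^^ m)"
        using m(1) by (intro S(2)[symmetric] funpow_galois_set frob_in_galois_set) auto
      also have "\<dots> = \<xi> frob [^] m"
        using \<xi> by (intro galois_hom_funpow frob_in_galois_set) (auto simp: continuous_homs_def)
      finally show ?thesis using m(2) eq by simp
    qed
    thus "\<xi> = \<eta>"
      using \<xi> \<eta> by (intro extensionalityI[of _ galois_set]) (auto simp: continuous_homs_def)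
  qed
  show "(\<lambda>\<xi>. \<xi> frob) ` ?H = carrier G"
  proof (intro equalityI subsetI)
    fix g assume "g \<in> (\<lambda>\<xi>. \<xi> frob) ` ?H"
    thus "g \<in> carrier G"
      using frob_in_galois_set by (auto simp: continuous_homs_def hom_def galois_group_def)
  next
    fix g assume g: "g \<in> carrier G"
    \<comment> \<open>Powers of \<open>g\<close> depend only on the exponent modulo the group order,
      and \<open>frob_fixed N\<close> distinguishes Frobenius powers exactly modulo
      \<open>N\<close>.\<close>
    define N where "N = Coset.order G"
    have N: "N > 0" using fin by (simp add: N_def order_gt_0_iff_finite)
    have pow_mod: "g [^] i = g [^] j" if "i mod N = j mod N" for i j :: nat
    proof -
      have "g [^] (N * k + r) = g [^] r" for k r :: nat
        using g pow_order_eq_1[OF g] by (simp add: N_def nat_pow_mult[symmetric] nat_pow_pow[symmetric])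
      from this[of "i div N" "i mod N"] this[of "j div N" "j mod N"]
      have "g [^] i = g [^] (i mod N)" "g [^] j = g [^] (j mod N)" by simp_all
      thus ?thesis using that by simp
    qed
    \<comment> \<open>An arbitrary choice of exponent; \<open>\<xi>_eq\<close> below shows that
      \<open>\<xi>\<close> does not depend on it.\<close>
    define m where "m \<sigma> = (SOME m. \<forall>x\<in>frob_fixed N. \<sigma> x = (frob ^^ m) x)"
      for \<sigma> :: "'k alg_closure \<Rightarrow> 'k alg_closure"
    have m: "\<sigma> x = (frob ^^ m \<sigma>) x" if "\<sigma> \<in> galois_set" "x \<in> frob_fixed N" for \<sigma> x
      using someI_ex[OF galois_eq_frob_on_finite[OF that(1) finite_frob_fixed[OF N]]] that(2)
      unfolding m_def by blast
    define \<xi> where "\<xi> = (\<lambda>\<sigma>\<in>galois_set. g [^] m \<sigma>)"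
    have \<xi>_eq: "\<xi> \<sigma> = g [^] i"
      if "\<sigma> \<in> galois_set" "\<And>x. x \<in> frob_fixed N \<Longrightarrow> \<sigma> x = (frob ^^ i) x" for \<sigma> i
    proof -
      have "m \<sigma> mod N = i mod N"
      proof (rule frob_funpow_eq_imp_cong[OF N], rule ballI)
        fix x :: "'k alg_closure" assume x: "x \<in> frob_fixed N"
        show "(frob ^^ m \<sigma>) x = (frob ^^ i) x"
          by (rule trans[OF m[OF that(1) x, symmetric] that(2)[OF x]])
      qed
      from pow_mod[OF this] that(1) show ?thesis by (simp add: \<xi>_def)
    qed
    have frob_fixed_closed: "(frob ^^ i) x \<in> frob_fixed N" if "x \<in> frob_fixed N" for i and x :: "'k alg_closure"
      using that galois_commutes_frob[OF funpow_galois_set[OF frob_in_galois_set], of i N x]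
      by (simp add: frob_fixed_def)
    have "\<xi> \<in> hom galois_group G"
    proof (rule homI)
      fix \<sigma> assume "\<sigma> \<in> carrier (galois_group :: ('k alg_closure \<Rightarrow> _) monoid)"
      thus "\<xi> \<sigma> \<in> carrier G" using g by (simp add: galois_group_def \<xi>_def)
    next
      fix \<sigma> \<tau> assume "\<sigma> \<in> carrier (galois_group :: ('k alg_closure \<Rightarrow> _) monoid)"
        "\<tau> \<in> carrier (galois_group :: ('k alg_closure \<Rightarrow> _) monoid)"
      hence \<sigma>\<tau>: "\<sigma> \<in> galois_set" "\<tau> \<in> galois_set" by (simp_all add: galois_group_def)
      have "\<xi> (\<sigma> \<circ> \<tau>) = g [^] (m \<sigma> + m \<tau>)"
      proof (rule \<xi>_eq)
        fix x :: "'k alg_closure" assume x: "x \<in> frob_fixed N"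
        show "(\<sigma> \<circ> \<tau>) x = (frob ^^ (m \<sigma> + m \<tau>)) x"
          unfolding funpow_add o_apply m[OF \<sigma>\<tau>(2) x]
          by (rule m[OF \<sigma>\<tau>(1) frob_fixed_closed[OF x]])
      qed (rule galois_set_comp[OF \<sigma>\<tau>])
      thus "\<xi> (\<sigma> \<otimes>\<^bsub>galois_group\<^esub> \<tau>) = \<xi> \<sigma> \<otimes> \<xi> \<tau>"
        using g \<sigma>\<tau> by (simp add: galois_group_def \<xi>_def nat_pow_mult)
    qed
    moreover have "continuous_map krull_topology (discrete_topology (carrier G)) \<xi>"
    proof -
      have "openin krull_topology {\<sigma> \<in> galois_set. \<xi> \<sigma> \<in> U}" for U
      proof (subst openin_subopen, rule ballI)
        fix \<sigma> assume \<sigma>: "\<sigma> \<in> {\<sigma> \<in> galois_set. \<xi> \<sigma> \<in> U}"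
        have "\<xi> \<tau> = \<xi> \<sigma>" if "\<tau> \<in> galois_set" "\<forall>x\<in>frob_fixed N. \<tau> x = \<sigma> x" for \<tau>
        proof -
          have \<sigma>': "\<sigma> \<in> galois_set" using \<sigma> by simp
          have "\<tau> x = (frob ^^ m \<sigma>) x" if "x \<in> frob_fixed N" for x
            by (rule trans[OF bspec[OF \<open>\<forall>x\<in>frob_fixed N. \<tau> x = \<sigma> x\<close> that] m[OF \<sigma>' that]])
          from \<xi>_eq[OF \<open>\<tau> \<in> galois_set\<close> this] \<sigma>' show ?thesis by (simp add: \<xi>_def)
        qed
        note const = this
        \<comment> \<open>\<open>\<xi>\<close> depends only on the restriction to the finite set
          \<open>frob_fixed N\<close>, so it is constant on this open cylinder around
          \<open>\<sigma>\<close>.\<close>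
        let ?C = "{\<tau> \<in> galois_set. \<forall>x\<in>frob_fixed N. \<tau> x = \<sigma> x}"
        have "\<tau> \<in> {\<sigma> \<in> galois_set. \<xi> \<sigma> \<in> U}" if "\<tau> \<in> ?C" for \<tau>
        proof -
          note \<tau> = CollectD[OF that, THEN conjunct1] CollectD[OF that, THEN conjunct2]
          show ?thesis unfolding mem_Collect_eq const[OF \<tau>] using \<tau>(1) \<sigma> by simp
        qed
        moreover have "openin krull_topology ?C"
          using \<sigma> by (intro openin_krull_cylinder finite_frob_fixed N) auto
        moreover have "\<sigma> \<in> ?C" using \<sigma> by simp
        ultimately show "\<exists>T. openin krull_topology T \<and> \<sigma> \<in> T \<and> T \<subseteq> {\<sigma> \<in> galois_set. \<xi> \<sigma> \<in> U}"
          by (intro exI[of _ ?C] conjI subsetI)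
      qed
      moreover have "\<xi> \<in> galois_set \<rightarrow> carrier G" using g by (auto simp: \<xi>_def)
      ultimately show ?thesis by (simp add: continuous_map_def topspace_krull)
    qed
    ultimately have "\<xi> \<in> ?H" by (simp add: continuous_homs_def \<xi>_def)
    moreover have "\<xi> frob = g"
      using \<xi>_eq[of frob 1] frob_in_galois_set g by simp
    ultimately show "g \<in> (\<lambda>\<xi>. \<xi> frob) ` ?H" by blast
  qed
qed

section \<open>Galois action on points\<close>

lemma quasiprojective_proj_space:
  assumes "quasiprojective k V"
  obtains n where "V \<subseteq> proj_space n"
  using assms unfolding quasiprojective_def zero_locus_def by blast

text \<open>Every vector in a point generates it by scaling, so two points are equal as soon as they
  share one coordinate vector.\<close>

lemma proj_space_eqI:
  assumes "P \<in> proj_space n" "Q \<in> proj_space n" "x \<in> P" "x \<in> Q"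
  shows "P = Q"
proof -
  have "P = {y. \<exists>c. c \<noteq> 0 \<and> y = (\<lambda>i. c * x i)}" if "P \<in> proj_space n" "x \<in> P" for P
  proof -
    obtain z where P: "P = {y. \<exists>c. c \<noteq> 0 \<and> y = (\<lambda>i. c * z i)}"
      using \<open>P \<in> proj_space n\<close> by (rule proj_spaceE)
    obtain b where b: "b \<noteq> 0" "x = (\<lambda>i. b * z i)" using \<open>x \<in> P\<close> P by auto
    have "(\<exists>c. c \<noteq> 0 \<and> y = (\<lambda>i. c * z i)) \<longleftrightarrow> (\<exists>c. c \<noteq> 0 \<and> y = (\<lambda>i. c * x i))" for y
    proof (intro iffI; elim exE conjE)
      fix c assume "c \<noteq> 0" "y = (\<lambda>i. c * z i)"
      thus "\<exists>c. c \<noteq> 0 \<and> y = (\<lambda>i. c * x i)" using b by (intro exI[of _ "c / b"]) simp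
    next
      fix c assume "c \<noteq> 0" "y = (\<lambda>i. c * x i)"
      thus "\<exists>c. c \<noteq> 0 \<and> y = (\<lambda>i. c * z i)"
        using b by (intro exI[of _ "c * b"]) (simp add: mult.assoc)
    qed
    thus ?thesis unfolding P by (simp only:)
  qed
  from this[OF assms(1,3)] this[OF assms(2,4)] show ?thesis by simp
qed

lemma galois_act_comp: "galois_act (\<sigma> \<circ> \<tau>) P = galois_act \<sigma> (galois_act \<tau> P)"
  by (simp add: galois_act_def image_image comp_assoc)

lemma galois_act_funpow_Suc: "galois_act (\<sigma> ^^ Suc m) P = galois_act (\<sigma> ^^ m) (galois_act \<sigma> P)"
  unfolding funpow_Suc_right by (rule galois_act_comp)

text \<open>A coordinate vector has entries up to index \<open>n\<close> and zeros beyond, which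
  automorphisms fix. At a single point an automorphism can therefore be replaced by a Frobenius
  power.\<close>

lemma galois_act_cong_finite:
  assumes "P \<in> proj_space n"
  shows "\<exists>S. finite S \<and> (\<forall>\<sigma>\<in>galois_set. \<forall>\<tau>\<in>galois_set.
     (\<forall>a\<in>S. \<sigma> a = \<tau> a) \<longrightarrow> galois_act \<sigma> P = galois_act \<tau> P)"
proof -
  obtain x where x: "x \<in> coord_vectors n" "P = {y. \<exists>c. c \<noteq> 0 \<and> y = (\<lambda>i. c * x i)}"
    using assms by (rule proj_spaceE)
  have "\<sigma> \<circ> x = \<tau> \<circ> x" if \<sigma>\<tau>: "\<sigma> \<in> galois_set" "\<tau> \<in> galois_set" "\<forall>a\<in>x ` {..n}. \<sigma> a = \<tau> a" for \<sigma> \<tau>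
  proof
    fix i show "(\<sigma> \<circ> x) i = (\<tau> \<circ> x) i"
      using \<sigma>\<tau>(3) x(1) galois_setD(5)[OF \<sigma>\<tau>(1)] galois_setD(5)[OF \<sigma>\<tau>(2)]
      by (cases "i \<le> n") (auto simp: coord_vectors_def)
  qed
  hence "galois_act \<sigma> P = galois_act \<tau> P"
    if "\<sigma> \<in> galois_set" "\<tau> \<in> galois_set" "\<forall>a\<in>x ` {..n}. \<sigma> a = \<tau> a" for \<sigma> \<tau>
    unfolding x(2) galois_act_class[OF that(1)] galois_act_class[OF that(2)] using that by (simp only:)
  moreover have "finite (x ` {..n})" by simp
  ultimately show ?thesis by (intro exI[of _ "x ` {..n}"] conjI ballI impI)
qed

text \<open>The forms that represent \<open>f\<close> near \<open>P\<close> have coefficients in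
  \<open>base_field\<close>, so their evaluation commutes with \<open>\<sigma>\<close>. Both points
  then contain the same coordinate vector.\<close>

lemma morphism_galois_equivariant:
  assumes V: "quasiprojective base_field V" and W: "quasiprojective base_field W"
    and f: "morphism base_field V W f" and \<sigma>: "\<sigma> \<in> galois_set" and P: "P \<in> V"
  shows "f (galois_act \<sigma> P) = galois_act \<sigma> (f P)"
proof -
  obtain d F where F: "\<And>i. form base_field d (F i)" and nz: "\<exists>i. \<not> vanishes_at (F i) P"
    and eq: "\<And>Q x. Q \<in> V \<Longrightarrow> x \<in> Q \<Longrightarrow> \<exists>i. peval (F i) x \<noteq> 0 \<Longrightarrow> (\<lambda>i. peval (F i) x) \<in> f Q"
    using f P unfolding morphism_def by meson
  obtain i x where x: "x \<in> P" "peval (F i) x \<noteq> 0"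
    using nz unfolding vanishes_at_def by blast
  let ?y = "\<lambda>i. peval (F i) x"
  have nonzero: "\<sigma> (?y i) \<noteq> 0"
    using x(2) galois_setD(1,5)[OF \<sigma>] by (metis bij_pointE)
  have \<sigma>P: "galois_act \<sigma> P \<in> V" by (rule galois_act_quasiprojective[OF \<sigma> V P])
  have "?y \<in> f P" using eq[OF P x(1)] x(2) by blast
  hence "\<sigma> \<circ> ?y \<in> galois_act \<sigma> (f P)" unfolding galois_act_def by (rule imageI)
  \<comment> \<open>The forms chosen at \<open>P\<close> also represent \<open>f\<close> at the
    conjugate of \<open>P\<close>: \<open>morphism\<close> demands agreement wherever they have no
    common zero, and \<open>\<sigma>\<close> preserves nonvanishing.\<close>
  moreover have "(\<lambda>i. peval (F i) (\<sigma> \<circ> x)) \<in> f (galois_act \<sigma> P)"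
  proof (rule eq[OF \<sigma>P])
    show "\<sigma> \<circ> x \<in> galois_act \<sigma> P" using x(1) unfolding galois_act_def by (rule imageI)
    show "\<exists>i. peval (F i) (\<sigma> \<circ> x) \<noteq> 0"
      using nonzero galois_peval[OF \<sigma> F] by (intro exI[of _ i]) simp
  qed
  hence "\<sigma> \<circ> ?y \<in> f (galois_act \<sigma> P)"
    using galois_peval[OF \<sigma> F] by (simp add: comp_def)
  moreover obtain n where n: "W \<subseteq> proj_space n" using W by (rule quasiprojective_proj_space)
  moreover have fV: "f Q \<in> W" if "Q \<in> V" for Q using f that by (auto simp: morphism_def)
  moreover have "galois_act \<sigma> (f P) \<in> W" by (rule galois_act_quasiprojective[OF \<sigma> W fV[OF P]])
  ultimately show ?thesis
    using fV[OF \<sigma>P] by (intro proj_space_eqI[of _ n _ "\<sigma> \<circ> ?y"]) auto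
qed

text \<open>A rational point is the class of a vector with entries in the finite set
  \<open>base_field\<close> and zeros beyond index \<open>n\<close>; there are finitely many such
  vectors.\<close>

lemma finite_rational_points:
  fixes V :: "'k::finite_field alg_closure point set"
  assumes "quasiprojective base_field V"
  shows "finite (rational_points V)"
proof -
  obtain n where n: "V \<subseteq> proj_space n" using assms by (rule quasiprojective_proj_space)
  let ?X = "{x :: nat \<Rightarrow> 'k alg_closure. \<forall>i. (i \<in> {..n} \<longrightarrow> x i \<in> base_field) \<and> (i \<notin> {..n} \<longrightarrow> x i = 0)}"
  have "finite ?X" by (intro finite_set_of_finite_funs) auto
  moreover have "\<exists>x\<in>?X. P = {y. \<exists>c. c \<noteq> 0 \<and> y = (\<lambda>i. c * x i)}" if P: "P \<in> rational_points V" for P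
  proof -
    obtain x where x: "x \<in> P" "\<forall>i. x i \<in> base_field" and PV: "P \<in> proj_space n"
      using P n by (auto simp: rational_points_def)
    obtain z where z: "z \<in> coord_vectors n" "P = {y. \<exists>c. c \<noteq> 0 \<and> y = (\<lambda>i. c * z i)}"
      using PV by (rule proj_spaceE)
    obtain c where c: "c \<noteq> 0" "x = (\<lambda>i. c * z i)" using x(1) z(2) by auto
    have xn: "x \<in> coord_vectors n" using z(1) c by (auto simp: coord_vectors_def)
    hence "{y. \<exists>c. c \<noteq> 0 \<and> y = (\<lambda>i. c * x i)} \<in> proj_space n"
      unfolding proj_space_def by (auto simp: quotient_def scaling_rel_def intro: bexI[of _ x])
    moreover have "x \<in> {y. \<exists>c. c \<noteq> 0 \<and> y = (\<lambda>i. c * x i)}" by (auto intro!: exI[of _ 1])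
    ultimately have "P = {y. \<exists>c. c \<noteq> 0 \<and> y = (\<lambda>i. c * x i)}"
      by (rule proj_space_eqI[OF PV _ x(1)])
    moreover have "x \<in> ?X" using x(2) xn by (simp add: coord_vectors_def)
    ultimately show ?thesis by (intro bexI[of _ x])
  qed
  hence "rational_points V \<subseteq> (\<lambda>x. {y. \<exists>c. c \<noteq> 0 \<and> y = (\<lambda>i. c * x i)}) ` ?X"
    by (intro subsetI) (simp only: image_iff)
  ultimately show ?thesis by (meson finite_imageI finite_subset)
qed

lemma galois_act_funpow_0: "galois_act (\<sigma> ^^ 0) P = P"
  by (simp add: galois_act_def comp_def)

text \<open>Rational means fixed by all automorphisms, and at the given point each of them acts as a
  power of Frobenius.\<close>

lemma fixed_by_frob_iff_rational:
  fixes V :: "'k::finite_field alg_closure point set"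
  assumes V: "quasiprojective base_field V" and P: "P \<in> V"
  shows "P \<in> rational_points V \<longleftrightarrow> galois_act frob P = P"
proof -
  have "galois_act \<sigma> P = P" if fixed: "galois_act frob P = P" and \<sigma>: "\<sigma> \<in> galois_set" for \<sigma>
  proof -
    obtain n where "V \<subseteq> proj_space n" using V by (rule quasiprojective_proj_space)
    hence "P \<in> proj_space n" using P by (rule subsetD)
    from galois_act_cong_finite[OF this] obtain S where S: "finite S" and cong: "\<forall>\<sigma>\<in>galois_set. \<forall>\<tau>\<in>galois_set.
        (\<forall>a\<in>S. \<sigma> a = \<tau> a) \<longrightarrow> galois_act \<sigma> P = galois_act \<tau> P"
      by (elim exE conjE)
    obtain m where m: "\<forall>a\<in>S. \<sigma> a = (frob ^^ m) a"
      using galois_eq_frob_on_finite[OF \<sigma> S] by (rule exE)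
    have "galois_act (frob ^^ m) P = P"
    proof (induction m)
      case 0
      show ?case by (rule galois_act_funpow_0)
    next
      case (Suc m)
      show ?case unfolding galois_act_funpow_Suc fixed by (rule Suc.IH)
    qed
    with cong[THEN bspec, OF \<sigma>, THEN bspec, OF funpow_galois_set[OF frob_in_galois_set], THEN mp, OF m]
    show ?thesis by (rule trans)
  qed
  thus ?thesis
    unfolding rational_points_eq[OF V] using P frob_in_galois_set by auto
qed

section \<open>Counting\<close>

text \<open>If \<open>F Q = act b Q0\<close>, right multiplication by \<open>b\<close> carries the
  solutions of \<open>Q = act g (F Q)\<close> to those of \<open>act g Q0 = Q\<close>. As
  \<open>Q\<close> runs through the orbit, the latter sets partition the group.\<close>

lemma (in comm_group) sum_card_twisted_stabilizers:
  assumes fin: "finite (carrier G)" and Q0: "Q0 \<in> V"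
    and act_mult: "\<And>g h P. g \<in> carrier G \<Longrightarrow> h \<in> carrier G \<Longrightarrow> P \<in> V \<Longrightarrow>
       act (g \<otimes> h) P = act g (act h P)"
    and F: "\<And>Q. Q \<in> (\<lambda>g. act g Q0) ` carrier G \<Longrightarrow> F Q \<in> (\<lambda>g. act g Q0) ` carrier G"
  shows "(\<Sum>Q\<in>(\<lambda>g. act g Q0) ` carrier G. card {g \<in> carrier G. Q = act g (F Q)}) = card (carrier G)"
proof -
  let ?O = "(\<lambda>g. act g Q0) ` carrier G"
  have "card {g \<in> carrier G. Q = act g (F Q)} = card {g \<in> carrier G. act g Q0 = Q}" if Q: "Q \<in> ?O" for Q
  proof -
    obtain b where b: "b \<in> carrier G" "F Q = act b Q0" using F[OF Q] by auto
    obtain a where a: "a \<in> carrier G" "Q = act a Q0" using Q by auto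
    have "bij_betw (\<lambda>g. g \<otimes> b) {g \<in> carrier G. Q = act g (F Q)} {g \<in> carrier G. act g Q0 = Q}"
    proof (rule bij_betw_byWitness[where f' = "\<lambda>g. g \<otimes> inv b"])
      have "act (g \<otimes> inv b) (act b Q0) = act g Q0" if "g \<in> carrier G" for g
        using that b(1) Q0 by (simp add: act_mult[symmetric] m_assoc)
      thus "(\<lambda>g. g \<otimes> inv b) ` {g \<in> carrier G. act g Q0 = Q} \<subseteq> {g \<in> carrier G. Q = act g (F Q)}"
        using b by auto
    qed (use b Q0 in \<open>auto simp: m_assoc act_mult\<close>)
    thus ?thesis by (rule bij_betw_same_card)
  qed
  hence "(\<Sum>Q\<in>?O. card {g \<in> carrier G. Q = act g (F Q)}) = (\<Sum>Q\<in>?O. card {g \<in> carrier G. act g Q0 = Q})"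
    by (intro sum.cong) auto
  also have "\<dots> = card (\<Union>Q\<in>?O. {g \<in> carrier G. act g Q0 = Q})"
    using fin by (intro card_UN_disjoint[symmetric]) auto
  also have "(\<Union>Q\<in>?O. {g \<in> carrier G. act g Q0 = Q}) = carrier G" by auto
  finally show ?thesis .
qed

lemma card_pairs_swap:
  assumes "finite A" "finite B"
  shows "(\<Sum>a\<in>A. card {b \<in> B. R a b}) = (\<Sum>b\<in>B. card {a \<in> A. R a b})"
  unfolding card_eq_sum by (rule sum.swap_restrict[OF assms])

text \<open>The pointwise content of the hypotheses: \<open>\<pi>\<close> is onto and its fibres are
  the orbits of \<open>G\<close>. The identities are restricted to points of \<open>V\<close>,
  because elements of \<open>G\<close> are extensional maps on \<open>V\<close>.\<close>

locale equivariant_quotient =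
  fixes V W :: "'k::finite_field alg_closure point set"
    and \<phi> \<phi>\<^sub>G \<pi> :: "'k alg_closure point \<Rightarrow> 'k alg_closure point"
    and G :: "('k alg_closure point \<Rightarrow> 'k alg_closure point) set"
  assumes V: "quasiprojective base_field V" and W: "quasiprojective base_field W"
    and \<phi>: "\<phi> \<in> V \<rightarrow> V"
    and subgroup: "subgroup G (aut_group base_field V)"
    and finite_G: "finite G"
    and comm: "comm_group (aut_group base_field V \<lparr>carrier := G\<rparr>)"
    and \<phi>_commutes: "g \<in> G \<Longrightarrow> P \<in> V \<Longrightarrow> \<phi> (g P) = g (\<phi> P)"
    and \<pi>: "morphism base_field V W \<pi>" and \<pi>_surj: "\<pi> ` V = W"
    and \<pi>_eq: "P \<in> V \<Longrightarrow> Q \<in> V \<Longrightarrow> \<pi> P = \<pi> Q \<longleftrightarrow> (\<exists>g\<in>G. Q = g P)"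
    and \<phi>\<^sub>G: "P \<in> V \<Longrightarrow> \<phi>\<^sub>G (\<pi> P) = \<pi> (\<phi> P)"
begin

section \<open>Actions of G, the Galois group and the endomorphism on points\<close>

abbreviation A where "A \<equiv> aut_group base_field V \<lparr>carrier := G\<rparr>"

sublocale A: comm_group A by (rule comm)

lemma H1_eq: "H1 V G = continuous_homs A"
  by (simp add: H1_def continuous_homs_def)

lemma G_Bij: "g \<in> G \<Longrightarrow> g \<in> Bij V"
  using subgroup.subset[OF subgroup] by (auto simp: aut_group_def)

lemma G_morphism: "g \<in> G \<Longrightarrow> morphism base_field V V g"
  using subgroup.subset[OF subgroup] by (auto simp: aut_group_def isomorphism_def)

lemma G_closed: "g \<in> G \<Longrightarrow> P \<in> V \<Longrightarrow> g P \<in> V"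
  using Bij_imp_funcset[OF G_Bij] by blast

lemma mult_apply: "g \<in> G \<Longrightarrow> h \<in> G \<Longrightarrow> P \<in> V \<Longrightarrow> (g \<otimes>\<^bsub>A\<^esub> h) P = g (h P)"
  by (simp add: aut_group_def BijGroup_def G_Bij compose_def)

lemma one_apply: "P \<in> V \<Longrightarrow> \<one>\<^bsub>A\<^esub> P = P"
  by (simp add: aut_group_def BijGroup_def)

lemma pow_in_G: "g \<in> G \<Longrightarrow> g [^]\<^bsub>A\<^esub> (n :: nat) \<in> G"
  using A.nat_pow_closed[of g n] by simp

lemma pow_Suc_apply: "g \<in> G \<Longrightarrow> P \<in> V \<Longrightarrow> (g [^]\<^bsub>A\<^esub> Suc n) P = (g [^]\<^bsub>A\<^esub> n) (g P)"
  unfolding A.nat_pow_Suc using mult_apply[OF pow_in_G] by blast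

lemma pow_0_apply: "P \<in> V \<Longrightarrow> (g [^]\<^bsub>A\<^esub> (0::nat)) P = P"
  unfolding A.nat_pow_0 by (rule one_apply)

lemma G_galois: "g \<in> G \<Longrightarrow> \<sigma> \<in> galois_set \<Longrightarrow> P \<in> V \<Longrightarrow> g (galois_act \<sigma> P) = galois_act \<sigma> (g P)"
  by (rule morphism_galois_equivariant[OF V V G_morphism])

lemma V_galois: "\<sigma> \<in> galois_set \<Longrightarrow> P \<in> V \<Longrightarrow> galois_act \<sigma> P \<in> V"
  by (rule galois_act_quasiprojective[OF _ V])

lemma \<pi>_galois: "\<sigma> \<in> galois_set \<Longrightarrow> P \<in> V \<Longrightarrow> \<pi> (galois_act \<sigma> P) = galois_act \<sigma> (\<pi> P)"
  by (rule morphism_galois_equivariant[OF V W \<pi>])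

lemma funpow_\<phi>_closed: "P \<in> V \<Longrightarrow> (\<phi> ^^ n) P \<in> V"
  using \<phi> by (induction n) auto

lemma funpow_\<phi>_commutes: "g \<in> G \<Longrightarrow> P \<in> V \<Longrightarrow> (\<phi> ^^ n) (g P) = g ((\<phi> ^^ n) P)"
  by (induction n) (simp_all add: \<phi>_commutes funpow_\<phi>_closed)

lemma funpow_\<phi>\<^sub>G: "P \<in> V \<Longrightarrow> (\<phi>\<^sub>G ^^ n) (\<pi> P) = \<pi> ((\<phi> ^^ n) P)"
  by (induction n) (simp_all add: \<phi>\<^sub>G funpow_\<phi>_closed)

text \<open>If the image has period \<open>n\<close>, then \<open>(\<phi> ^^ n) P = g P\<close> for
  some \<open>g\<close> in \<open>G\<close>. As \<open>g\<close> commutes with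
  \<open>\<phi>\<close>, the iterate \<open>\<phi> ^^ (n * k)\<close> acts on \<open>P\<close> as
  the \<open>k\<close>-th power of \<open>g\<close>, and \<open>k = card G\<close> gives
  \<open>P\<close> back.\<close>

lemma periodic_iff:
  assumes P: "P \<in> V"
  shows "(\<exists>n\<ge>1. (\<phi>\<^sub>G ^^ n) (\<pi> P) = \<pi> P) \<longleftrightarrow> (\<exists>n\<ge>1. (\<phi> ^^ n) P = P)"
proof
  assume "\<exists>n\<ge>1. (\<phi> ^^ n) P = P"
  then obtain n where "n \<ge> 1" "(\<phi> ^^ n) P = P" by (elim exE conjE)
  thus "\<exists>n\<ge>1. (\<phi>\<^sub>G ^^ n) (\<pi> P) = \<pi> P"
    using funpow_\<phi>\<^sub>G[OF P] by (intro exI[of _ n]) simp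
next
  assume "\<exists>n\<ge>1. (\<phi>\<^sub>G ^^ n) (\<pi> P) = \<pi> P"
  then obtain n where n: "n \<ge> 1" "\<pi> P = \<pi> ((\<phi> ^^ n) P)" using funpow_\<phi>\<^sub>G[OF P] by metis
  then obtain g where g: "g \<in> G" "(\<phi> ^^ n) P = g P"
    using \<pi>_eq[OF P funpow_\<phi>_closed[OF P]] by metis
  have pow: "(\<phi> ^^ (n * k)) P = (g [^]\<^bsub>A\<^esub> k) P" for k
  proof (induction k)
    case 0
    show ?case using pow_0_apply[OF P] by simp
  next
    case (Suc k)
    have "(\<phi> ^^ (n * Suc k)) P = (\<phi> ^^ n) ((\<phi> ^^ (n * k)) P)"
      by (simp add: funpow_add)
    also have "\<dots> = (g [^]\<^bsub>A\<^esub> k) (g P)"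
      unfolding Suc.IH funpow_\<phi>_commutes[OF pow_in_G[OF g(1)] P] g(2) ..
    finally show ?case using pow_Suc_apply[OF g(1) P] by simp
  qed
  have "card G > 0" using A.one_closed finite_G by (auto simp: card_gt_0_iff)
  moreover have "(\<phi> ^^ (n * card G)) P = P"
    using A.pow_order_eq_1[of g] g(1) one_apply[OF P] by (simp add: pow Coset.order_def)
  ultimately show "\<exists>n\<ge>1. (\<phi> ^^ n) P = P" using n(1) by (intro exI[of _ "n * card G"]) simp
qed

text \<open>The fixed-point equation is substituted into itself \<open>m\<close> times; the copies
  of \<open>g\<close> collect on the left because \<open>g\<close> is defined over the base field
  and commutes with Frobenius.\<close>

lemma frob_pow_fixed:
  assumes g: "g \<in> G" and Q: "Q \<in> V" and fixed: "Q = g (galois_act frob Q)"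
  shows "Q = (g [^]\<^bsub>A\<^esub> m) (galois_act (frob ^^ m) Q)"
proof (induction m)
  case 0
  show ?case unfolding galois_act_funpow_0 by (rule pow_0_apply[OF Q, symmetric])
next
  case (Suc m)
  let ?Q = "galois_act frob Q"
  have F: "(frob ^^ m :: 'k alg_closure \<Rightarrow> _) \<in> galois_set"
    by (rule funpow_galois_set[OF frob_in_galois_set])
  have Q': "?Q \<in> V" by (rule V_galois[OF frob_in_galois_set Q])
  have "galois_act (frob ^^ m) Q = galois_act (frob ^^ m) (g ?Q)" using fixed by simp
  also have "\<dots> = g (galois_act (frob ^^ m) ?Q)" by (rule G_galois[OF g F Q', symmetric])
  finally have "Q = (g [^]\<^bsub>A\<^esub> m) (g (galois_act (frob ^^ m) ?Q))" using Suc.IH by simp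
  thus ?case
    unfolding galois_act_funpow_Suc using pow_Suc_apply[OF g V_galois[OF F Q']] by simp
qed

text \<open>A single \<open>m\<close> makes \<open>\<sigma>\<close> act on \<open>Q\<close> as
  \<open>frob ^^ m\<close> and \<open>\<xi> \<sigma>\<close> equal the \<open>m\<close>-th power of
  \<open>\<xi> frob\<close>, so the condition at Frobenius implies the one at
  \<open>\<sigma>\<close>.\<close>

lemma twisted_fixed_iff:
  assumes \<xi>: "\<xi> \<in> H1 V G" and Q: "Q \<in> V"
  shows "(\<forall>\<sigma>\<in>galois_set. Q = \<xi> \<sigma> (galois_act \<sigma> Q)) \<longleftrightarrow> Q = \<xi> frob (galois_act frob Q)"
proof (intro iffI ballI)
  fix \<sigma> :: "'k alg_closure \<Rightarrow> 'k alg_closure"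
  assume fixed: "Q = \<xi> frob (galois_act frob Q)" and \<sigma>: "\<sigma> \<in> galois_set"
  obtain n where "V \<subseteq> proj_space n" using V by (rule quasiprojective_proj_space)
  hence "Q \<in> proj_space n" using Q by (rule subsetD)
  from galois_act_cong_finite[OF this] obtain S where S: "finite S" and cong: "\<forall>\<sigma>\<in>galois_set. \<forall>\<tau>\<in>galois_set.
      (\<forall>a\<in>S. \<sigma> a = \<tau> a) \<longrightarrow> galois_act \<sigma> Q = galois_act \<tau> Q"
    by (elim exE conjE)
  have \<xi>': "\<xi> \<in> continuous_homs A" using \<xi> unfolding H1_eq .
  have "\<xi> frob \<in> G"
    using \<xi>' frob_in_galois_set by (auto simp: continuous_homs_def hom_def galois_group_def)
  from A.continuous_hom_via_frob[OF \<xi>' \<sigma> S] obtain m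
    where m: "\<forall>a\<in>S. \<sigma> a = (frob ^^ m) a" "\<xi> \<sigma> = \<xi> frob [^]\<^bsub>A\<^esub> m" by (elim exE conjE)
  have "galois_act \<sigma> Q = galois_act (frob ^^ m) Q"
    by (rule cong[THEN bspec, OF \<sigma>, THEN bspec, OF funpow_galois_set[OF frob_in_galois_set], THEN mp, OF m(1)])
  thus "Q = \<xi> \<sigma> (galois_act \<sigma> Q)"
    using frob_pow_fixed[OF \<open>\<xi> frob \<in> G\<close> Q fixed, of m] m(2) by simp
qed (rule bspec[OF _ frob_in_galois_set])

section \<open>Periodic points of the twists and of the quotient\<close>

definition periodic_quotient where
  "periodic_quotient = periodic_points \<phi>\<^sub>G (rational_points W)"

text \<open>These points are in general not rational themselves. The set is finite and contains the
  points of \<open>V\<close> that correspond to periodic rational points of any of the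
  twists.\<close>

definition periodic_preimage where
  "periodic_preimage = {Q \<in> V. \<pi> Q \<in> periodic_quotient}"

lemma finite_periodic_quotient: "finite periodic_quotient"
  using finite_rational_points[OF W]
  by (rule rev_finite_subset) (auto simp: periodic_quotient_def periodic_points_def)

lemma fibre_eq_orbit:
  assumes "Q0 \<in> V"
  shows "{Q \<in> V. \<pi> Q = \<pi> Q0} = (\<lambda>g. g Q0) ` G"
  using \<pi>_eq[OF assms] G_closed[OF _ assms] by (auto simp: eq_commute)

lemma finite_fibre: "finite {Q \<in> V. \<pi> Q = P}"
proof (cases "\<exists>Q0\<in>V. \<pi> Q0 = P")
  case True
  then obtain Q0 where "Q0 \<in> V" "\<pi> Q0 = P" by (elim bexE)
  thus ?thesis using fibre_eq_orbit finite_G by auto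
next
  case False
  hence "{Q \<in> V. \<pi> Q = P} = {}" by auto
  thus ?thesis by (simp only: finite.emptyI)
qed

lemma finite_periodic_preimage: "finite periodic_preimage"
proof -
  have "periodic_preimage = (\<Union>P\<in>periodic_quotient. {Q \<in> V. \<pi> Q = P})"
    by (auto simp: periodic_preimage_def)
  thus ?thesis using finite_periodic_quotient finite_fibre by simp
qed

text \<open>\<open>\<psi>\<close> conjugates \<open>\<phi>\<close> to the twisted map, so the count
  can be made on \<open>V\<close>; there rationality on the twist becomes the single equation at
  Frobenius. The resulting number involves neither \<open>V'\<close> nor
  \<open>\<psi>\<close>.\<close>

lemma periodic_twist_card:
  assumes \<xi>: "\<xi> \<in> H1 V G" and tw: "is_twist V \<xi> V' \<psi>"
  shows "card (periodic_points (twisted_map V \<phi> \<psi>) (rational_points V')) =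
    card {Q \<in> periodic_preimage. Q = \<xi> frob (galois_act frob Q)}"
proof -
  let ?R = "{Q \<in> V. \<forall>\<sigma>\<in>galois_set. Q = \<xi> \<sigma> (galois_act \<sigma> Q)}"
  have bij: "bij_betw \<psi> V V'" using tw by (simp add: is_twist_def isomorphism_def)
  hence inj: "inj_on \<psi> V" by (rule bij_betw_imp_inj_on)
  have conj: "(twisted_map V \<phi> \<psi> ^^ n) (\<psi> Q) = \<psi> ((\<phi> ^^ n) Q)" if "Q \<in> V" for n Q
    using funpow_\<phi>_closed[OF that]
    by (induction n) (simp_all add: twisted_map_def inv_into_f_f[OF inj])
  have "periodic_points (twisted_map V \<phi> \<psi>) (rational_points V') =
      \<psi> ` {Q \<in> ?R. \<exists>n\<ge>1. (\<phi> ^^ n) Q = Q}"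
  proof -
    have "(\<exists>n\<ge>1. (twisted_map V \<phi> \<psi> ^^ n) (\<psi> Q) = \<psi> Q) \<longleftrightarrow> (\<exists>n\<ge>1. (\<phi> ^^ n) Q = Q)"
      if "Q \<in> V" for Q
      unfolding conj[OF that] inj_on_eq_iff[OF inj funpow_\<phi>_closed[OF that] that] ..
    hence "{Q \<in> ?R. \<exists>n\<ge>1. (\<phi> ^^ n) Q = Q} =
        {Q \<in> ?R. \<exists>n\<ge>1. (twisted_map V \<phi> \<psi> ^^ n) (\<psi> Q) = \<psi> Q}"
      by (intro Collect_cong conj_cong refl) simp
    thus ?thesis
      unfolding periodic_points_def twist_rational_points[OF V subgroup \<xi> tw, symmetric]
      by (simp only:) (rule Compr_image_eq)
  qed
  also have "card \<dots> = card {Q \<in> ?R. \<exists>n\<ge>1. (\<phi> ^^ n) Q = Q}"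
    by (intro card_image inj_on_subset[OF inj]) auto
  also have "{Q \<in> ?R. \<exists>n\<ge>1. (\<phi> ^^ n) Q = Q} =
      {Q \<in> periodic_preimage. Q = \<xi> frob (galois_act frob Q)}"
  proof -
    \<comment> \<open>\<open>\<pi>\<close> is invariant under \<open>\<xi> frob\<close> and commutes
      with Frobenius, so the image of \<open>Q\<close> is fixed by Frobenius.\<close>
    have rational: "\<pi> Q \<in> rational_points W" if Q: "Q \<in> V" and fixed: "Q = \<xi> frob (galois_act frob Q)" for Q
    proof -
      have "\<xi> frob \<in> G"
        using \<xi> frob_in_galois_set by (auto simp: H1_def hom_def galois_group_def)
      hence "\<pi> (galois_act frob Q) = \<pi> Q"
        using \<pi>_eq[OF V_galois[OF frob_in_galois_set Q] Q] fixed by metis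
      thus ?thesis
        using fixed_by_frob_iff_rational[OF W, of "\<pi> Q"] \<pi>_galois[OF frob_in_galois_set Q] Q \<pi>_surj
        by auto
    qed
    show ?thesis
    proof (rule Collect_cong)
      fix Q
      show "Q \<in> ?R \<and> (\<exists>n\<ge>1. (\<phi> ^^ n) Q = Q) \<longleftrightarrow>
          Q \<in> periodic_preimage \<and> Q = \<xi> frob (galois_act frob Q)"
        unfolding periodic_preimage_def periodic_quotient_def periodic_points_def mem_Collect_eq
        using twisted_fixed_iff[OF \<xi>, of Q] periodic_iff[of Q] rational[of Q] by argo
    qed
  qed
  finally show ?thesis .
qed

text \<open>The fibre over a rational point is one orbit, and Frobenius maps it to itself because
  \<open>\<pi>\<close> commutes with Frobenius. The count on a single orbit then applies.\<close>

lemma fibre_count: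
  assumes P: "P \<in> periodic_quotient"
  shows "(\<Sum>Q | Q \<in> V \<and> \<pi> Q = P. card {g \<in> G. Q = g (galois_act frob Q)}) = card G"
proof -
  have PW: "P \<in> rational_points W" "P \<in> W"
    using P by (auto simp: periodic_quotient_def periodic_points_def rational_points_def)
  hence frobP: "galois_act frob P = P" using fixed_by_frob_iff_rational[OF W] by blast
  obtain Q0 where Q0: "Q0 \<in> V" "\<pi> Q0 = P" using PW(2) \<pi>_surj by auto
  have orbit: "{Q \<in> V. \<pi> Q = P} = (\<lambda>g. g Q0) ` carrier A"
    using fibre_eq_orbit[OF Q0(1)] Q0(2) by simp
  have stable: "galois_act frob Q \<in> (\<lambda>g. g Q0) ` carrier A" if "Q \<in> (\<lambda>g. g Q0) ` carrier A" for Q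
  proof -
    have "Q \<in> V" "\<pi> Q = P" using that unfolding orbit[symmetric] by simp_all
    thus ?thesis
      unfolding orbit[symmetric] using V_galois[OF frob_in_galois_set] \<pi>_galois[OF frob_in_galois_set] frobP by simp
  qed
  have "(\<Sum>Q\<in>(\<lambda>g. g Q0) ` carrier A. card {g \<in> carrier A. Q = g (galois_act frob Q)}) = card (carrier A)"
    by (rule A.sum_card_twisted_stabilizers[where act = "\<lambda>g. g" and V = V])
      (use finite_G Q0(1) mult_apply stable in \<open>simp_all del: partial_object.simps\<close>)
  thus ?thesis unfolding orbit by simp
qed

text \<open>Evaluation at Frobenius turns the sum over \<open>H1 V G\<close> into a sum over
  \<open>G\<close>. The pairs of \<open>g\<close> and \<open>Q\<close> are then counted by
  \<open>Q\<close> first and grouped by the image of \<open>Q\<close>, each fibre contributing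
  \<open>card G\<close>.\<close>

lemma sum_twists:
  "(\<Sum>\<xi>\<in>H1 V G. card {Q \<in> periodic_preimage. Q = \<xi> frob (galois_act frob Q)}) =
   card G * card periodic_quotient"
proof -
  let ?B = periodic_preimage and ?fix = "\<lambda>g Q. Q = g (galois_act frob Q)"
  have "bij_betw (\<lambda>\<xi>. \<xi> frob) (H1 V G) G"
    using A.bij_betw_continuous_homs finite_G unfolding H1_eq by simp
  hence "(\<Sum>\<xi>\<in>H1 V G. card {Q \<in> ?B. ?fix (\<xi> frob) Q}) = (\<Sum>g\<in>G. card {Q \<in> ?B. ?fix g Q})"
    by (rule sum.reindex_bij_betw)
  also have "\<dots> = (\<Sum>Q\<in>?B. card {g \<in> G. ?fix g Q})"
    by (rule card_pairs_swap[OF finite_G finite_periodic_preimage])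
  also have "\<dots> = (\<Sum>P\<in>periodic_quotient. \<Sum>Q | Q \<in> ?B \<and> \<pi> Q = P. card {g \<in> G. ?fix g Q})"
    by (rule sum.group[symmetric, OF finite_periodic_preimage finite_periodic_quotient])
      (auto simp: periodic_preimage_def)
  also have "\<dots> = (\<Sum>P\<in>periodic_quotient. card G)"
  proof (rule sum.cong[OF refl])
    fix P assume P: "P \<in> periodic_quotient"
    hence "{Q. Q \<in> ?B \<and> \<pi> Q = P} = {Q. Q \<in> V \<and> \<pi> Q = P}" by (auto simp: periodic_preimage_def)
    thus "(\<Sum>Q | Q \<in> ?B \<and> \<pi> Q = P. card {g \<in> G. ?fix g Q}) = card G"
      using fibre_count[OF P] by simp
  qed
  finally show ?thesis by (simp add: mult.commute)
qed

end

text \<open>\<open>V_tw\<close> and \<open>\<psi>\<close> are an arbitrary choice of one twist for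
  each class.\<close>

theorem theorem1p6:
  fixes V W :: "'k::finite_field alg_closure point set"
    and \<phi> \<phi>\<^sub>G \<pi> :: "'k alg_closure point \<Rightarrow> 'k alg_closure point"
    and G :: "('k alg_closure point \<Rightarrow> 'k alg_closure point) set"
    and V_tw :: "(('k alg_closure \<Rightarrow> 'k alg_closure) \<Rightarrow>
                    'k alg_closure point \<Rightarrow> 'k alg_closure point) \<Rightarrow> 'k alg_closure point set"
    and \<psi> :: "(('k alg_closure \<Rightarrow> 'k alg_closure) \<Rightarrow>
                    'k alg_closure point \<Rightarrow> 'k alg_closure point) \<Rightarrow>
                    'k alg_closure point \<Rightarrow> 'k alg_closure point"
  assumes "quasiprojective base_field V"
    and "morphism base_field V V \<phi>"
    and "subgroup G (aut_group base_field V)"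
    and "finite G"
    and "comm_group (aut_group base_field V \<lparr>carrier := G\<rparr>)"
    and "\<forall>g\<in>G. \<forall>P\<in>V. \<phi> (g P) = g (\<phi> P)"
    and "quotient_variety base_field V G W \<pi>"
    and "morphism base_field W W \<phi>\<^sub>G"
    and "\<forall>P\<in>V. \<phi>\<^sub>G (\<pi> P) = \<pi> (\<phi> P)"
    and "\<forall>\<xi>\<in>H1 V G. is_twist V \<xi> (V_tw \<xi>) (\<psi> \<xi>)"
  shows "real (card (periodic_points \<phi>\<^sub>G (rational_points W))) =
    1 / real (card G) *
      (\<Sum>\<xi>\<in>H1 V G. real (card (periodic_points (twisted_map V \<phi> (\<psi> \<xi>)) (rational_points (V_tw \<xi>)))))"
proof -
  interpret equivariant_quotient V W \<phi> \<phi>\<^sub>G \<pi> G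
  proof (rule equivariant_quotient.intro)
    show W: "quasiprojective base_field W" and "morphism base_field V W \<pi>"
      using assms(7) by (simp_all add: quotient_variety_def)
    have "quotient_map (zariski_topology V) (zariski_topology W) \<pi>"
      using assms(7) by (simp add: quotient_variety_def)
    \<comment> \<open>The underlying space of each Zariski topology is the whole quasiprojective
      set, since points of projective space are nonempty classes.\<close>
    from quotient_imp_surjective_map[OF this] show "\<pi> ` V = W"
      by (simp add: topspace_zariski_quasiprojective[OF assms(1)] topspace_zariski_quasiprojective[OF W])
    show "\<pi> P = \<pi> Q \<longleftrightarrow> (\<exists>g\<in>G. Q = g P)" if "P \<in> V" "Q \<in> V" for P Q
      using assms(7) that unfolding quotient_variety_def by blast
    show "\<phi> \<in> V \<rightarrow> V" using assms(2) by (simp add: morphism_def)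
  qed (rule assms(1,3,4,5) assms(6)[THEN bspec, THEN bspec] assms(9)[THEN bspec]; assumption?)+
  have "(\<Sum>\<xi>\<in>H1 V G. card (periodic_points (twisted_map V \<phi> (\<psi> \<xi>)) (rational_points (V_tw \<xi>)))) =
      (\<Sum>\<xi>\<in>H1 V G. card {Q \<in> periodic_preimage. Q = \<xi> frob (galois_act frob Q)})"
    using assms(10) by (intro sum.cong periodic_twist_card) auto
  also have "\<dots> = card G * card (periodic_points \<phi>\<^sub>G (rational_points W))"
    unfolding sum_twists periodic_quotient_def ..
  finally have "(\<Sum>\<xi>\<in>H1 V G. real (card (periodic_points (twisted_map V \<phi> (\<psi> \<xi>)) (rational_points (V_tw \<xi>))))) =
      real (card G) * real (card (periodic_points \<phi>\<^sub>G (rational_points W)))"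
    by (simp flip: of_nat_sum of_nat_mult)
  \<comment> \<open>\<open>G\<close> is finite and contains the unit, so dividing by its order is
    legitimate.\<close>
  moreover have "card G \<noteq> 0"
    using finite_G A.one_closed by (auto simp: card_eq_0_iff)
  ultimately show ?thesis by simp
qed

end
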